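(* Consider the linear system $\dot{\mathbf{x}} = \mathbf{A}\mathbf{x} + \mathbf{B}\mathbf{u}$ with $\mathbf{A}\in\mathbb{R}^{n\times n}$, $\mathbf{B}\in\mathbb{R}^{n\times m}$, and affine constraint functions $h_i(\mathbf{x}) = \mathbf{c}_i^\top\mathbf{x}+d_i$, $i\in[\bar p]$, where $h_i$ has relative degree $r_i\geq 1$, together with constants $\alpha_{i,j}>0$ ($i\in[\bar p]$, $j\in[r_i]$). Let $\boldsymbol{\ell}_i = \mathbf{B}^\top(\mathbf{A}^{r_i-1})^\top\mathbf{c}_i$, and assume that $\{\boldsymbol{\ell}_i\}_{i=1}^{p}$ are linearly independent, that $\{\boldsymbol{\ell}_i\}_{i=p+1}^{\bar p}$ are linear combinations of $\{\boldsymbol{\ell}_i\}_{i=1}^{p}$, and that $p<m$. Suppose that: 1. $d_i\geq 0$ for all $i\in[\bar p]$; 2. $\mathbf{c}_i^\top\boldsymbol{\Phi}_i(\mathbf{A})-\boldsymbol{\ell}_i^\top\mathbf{K}_0=\mathbf{0}_n^\top$ for all $i\in[\bar p]\setminus[p]$; 3. $(\mathbf{A}-\mathbf{B}\mathbf{K}_0,\mathbf{B}\mathbf{L}_\perp)$ is stabilizable. Given symmetric positive definite $\mathbf{Q}\in\mathbb{R}^{n\times n}$ and $\mathbf{R}\in\mathbb{R}^{m\times m}$, define $\mathbf{A}_s=\mathbf{A}-\mathbf{B}\mathbf{K}_0$, $\mathbf{B}_s=\mathbf{B}\mathbf{L}_\perp$, $\mathbf{Q}_s=\mathbf{Q}+\mathbf{K}_0^\top\mathbf{R}\mathbf{K}_0$,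 $\mathbf{S}_s=-\mathbf{K}_0^\top\mathbf{R}\mathbf{L}_\perp$, $\mathbf{R}_s=\mathbf{L}_\perp^\top\mathbf{R}\mathbf{L}_\perp$. Then the generalized algebraic Riccati equation $$\mathbf{A}_s^\top\mathbf{P}+\mathbf{P}\mathbf{A}_s-(\mathbf{P}\mathbf{B}_s+\mathbf{S}_s)\mathbf{R}_s^{-1}(\mathbf{B}_s^\top\mathbf{P}+\mathbf{S}_s^\top)+\mathbf{Q}_s=\mathbf{0}_{n\times n}$$ has a unique symmetric positive definite solution $\mathbf{P}=\mathbf{P}^\top\succ 0$, and the matrix $$\mathbf{K}^\star=\mathbf{K}_0+\mathbf{L}_\perp\mathbf{R}_s^{-1}(\mathbf{B}_s^\top\mathbf{P}+\mathbf{S}_s^\top)$$ satisfies $\mathbf{K}^\star\in\mathcal{M}$ and $$J(\mathbf{x}_0,\mathbf{K}^\star)=\min_{\mathbf{K}\in\mathcal{M}}J(\mathbf{x}_0,\mathbf{K})\qquad\text{for all }\mathbf{x}_0\in\mathbb{R}^n.$$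
   Context: $[k]=\{1,\dots,k\}$. For the linear system, $h_i(\mathbf{x})=\mathbf{c}_i^\top\mathbf{x}+d_i$ (with $\mathbf{c}_i\in\mathbb{R}^n$, $d_i\in\mathbb{R}$) has relative degree $r_i\in\mathbb{Z}_{>0}$ if $\mathbf{c}_i^\top\mathbf{A}^{r_i-1}\mathbf{B}\neq\mathbf{0}$ and $\mathbf{c}_i^\top\mathbf{A}^{k}\mathbf{B}=\mathbf{0}$ for all $0\le k<r_i-1$. Set $\boldsymbol{\Phi}_i(\mathbf{A})=\prod_{l=1}^{r_i}(\mathbf{A}+\alpha_{i,l}\mathbf{I}_n)$ and $\alpha_i=\prod_{j=1}^{r_i}\alpha_{i,j}$. The $i$-th HOCBF (high-order control barrier function) constraint on a pair $(\mathbf{x},\mathbf{u})$ is $\mathbf{c}_i^\top\boldsymbol{\Phi}_i(\mathbf{A})\mathbf{x}+\mathbf{c}_i^\top\mathbf{A}^{r_i-1}\mathbf{B}\mathbf{u}+\alpha_i d_i\geq 0$. $\mathbf{L}\in\mathbb{R}^{m\times p}$ is the matrix with columns $\boldsymbol{\ell}_1,\dots,\boldsymbol{\ell}_p$; $\mathbf{L}_\perp\in\mathbb{R}^{m\times(m-p)}$ is a matrix whose columns form a basis of $\ker(\mathbf{L}^\top)$; $\tilde{\mathbf{C}}\in\mathbb{R}^{p\times n}$ is the matrix whose $i$-th row is $\mathbf{c}_i^\top\boldsymbol{\Phi}_i(\mathbf{A})$, $i\in[p]$; $\mathbf{K}_0=\mathbf{L}(\mathbf{L}^\top\mathbf{L})^{-1}\tilde{\mathbf{C}}$.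 $\mathcal{M}\subseteq\mathbb{R}^{m\times n}$ is the set of gain matrices $\mathbf{K}$ such that $\mathbf{u}=-\mathbf{K}\mathbf{x}$ renders the origin globally exponentially stable (i.e. $\mathbf{A}-\mathbf{B}\mathbf{K}$ is Hurwitz: all eigenvalues have negative real part) and satisfies all $\bar p$ HOCBF constraints for all $\mathbf{x}\in\mathbb{R}^n$. For $\mathbf{K}\in\mathcal{M}$ and $\mathbf{x}_0\in\mathbb{R}^n$, $J(\mathbf{x}_0,\mathbf{K})=\int_0^\infty\big(\mathbf{x}(t)^\top\mathbf{Q}\mathbf{x}(t)+(\mathbf{K}\mathbf{x}(t))^\top\mathbf{R}\,\mathbf{K}\mathbf{x}(t)\big)\,dt$, where $\mathbf{x}(t)$ solves $\dot{\mathbf{x}}=(\mathbf{A}-\mathbf{B}\mathbf{K})\mathbf{x}$, $\mathbf{x}(0)=\mathbf{x}_0$. A pair $(\mathbf{F},\mathbf{G})$ is stabilizable if there is a matrix $\mathbf{H}$ with $\mathbf{F}-\mathbf{G}\mathbf{H}$ Hurwitz. *)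

theory Defs
  imports "HOL-Analysis.Analysis"
begin

(* The class operations * and ^ on real^'n^'n act entrywise, so powers with respect to ** are
   defined here. *)
primrec mat_pow :: "real^'n^'n \<Rightarrow> nat \<Rightarrow> real^'n^'n" where
  "mat_pow A 0 = mat 1"
| "mat_pow A (Suc k) = A ** mat_pow A k"

definition sym_pos_def :: "real^'n^'n \<Rightarrow> bool" where
  "sym_pos_def M \<longleftrightarrow> transpose M = M \<and> (\<forall>x. x \<noteq> 0 \<longrightarrow> x \<bullet> (M *v x) > 0)"

definition hurwitz :: "real^'n^'n \<Rightarrow> bool" where
  "hurwitz M \<longleftrightarrow>
     (\<forall>(z::complex) (v::complex^'n).
        v \<noteq> 0 \<and> map_matrix complex_of_real M *v v = z *s v \<longrightarrow> Re z < 0)"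

definition stabilizable :: "real^'n^'n \<Rightarrow> real^'k^'n \<Rightarrow> bool" where
  "stabilizable F G \<longleftrightarrow> (\<exists>H::real^'n^'k. hurwitz (F - G ** H))"

(* The offset d of h(x) = c . x + d does not affect the relative degree. *)
definition has_relative_degree ::
    "real^'n^'n \<Rightarrow> real^'m^'n \<Rightarrow> real^'n \<Rightarrow> nat \<Rightarrow> bool" where
  "has_relative_degree A B c r \<longleftrightarrow>
     r \<ge> 1 \<and> c v* (mat_pow A (r - 1) ** B) \<noteq> 0 \<and>
     (\<forall>k < r - 1. c v* (mat_pow A k ** B) = 0)"

(* hocbf_poly A a r is the product of A + a l I over l = 1, ..., r; the factors commute.
   mat s is the scalar matrix s I. *)
primrec hocbf_poly :: "real^'n^'n \<Rightarrow> (nat \<Rightarrow> real) \<Rightarrow> nat \<Rightarrow> real^'n^'n" where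
  "hocbf_poly A a 0 = mat 1"
| "hocbf_poly A a (Suc k) = hocbf_poly A a k ** (A + mat (a (Suc k)))"

definition hocbf_constraint ::
    "real^'n^'n \<Rightarrow> real^'m^'n \<Rightarrow> real^'n \<Rightarrow> real \<Rightarrow> nat \<Rightarrow> (nat \<Rightarrow> real) \<Rightarrow>
     real^'n \<Rightarrow> real^'m \<Rightarrow> bool" where
  "hocbf_constraint A B c d r a x u \<longleftrightarrow>
     (c v* hocbf_poly A a r) \<bullet> x + (c v* (mat_pow A (r - 1) ** B)) \<bullet> u
       + (\<Prod>j=1..r. a j) * d \<ge> 0"

definition feasible_gains ::
    "real^'n^'n \<Rightarrow> real^'m^'n \<Rightarrow> nat \<Rightarrow> (nat \<Rightarrow> real^'n) \<Rightarrow> (nat \<Rightarrow> real) \<Rightarrow>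
     (nat \<Rightarrow> nat) \<Rightarrow> (nat \<Rightarrow> nat \<Rightarrow> real) \<Rightarrow> (real^'n^'m) set" where
  "feasible_gains A B pbar c d r \<alpha> =
     {K. hurwitz (A - B ** K) \<and>
         (\<forall>i\<in>{1..pbar}. \<forall>x. hocbf_constraint A B (c i) (d i) (r i) (\<alpha> i) x (- (K *v x)))}"

definition is_trajectory :: "real^'n^'n \<Rightarrow> real^'n \<Rightarrow> (real \<Rightarrow> real^'n) \<Rightarrow> bool" where
  "is_trajectory M x0 x \<longleftrightarrow>
     x 0 = x0 \<and> (\<forall>t\<ge>0. (x has_vector_derivative M *v x t) (at t within {0..}))"

(* A trajectory exists and is determined on {0..}; its values at negative times are arbitrary
   and do not enter the cost, so the cost does not depend on the choice made by SOME. *)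
definition trajectory :: "real^'n^'n \<Rightarrow> real^'n \<Rightarrow> real \<Rightarrow> real^'n" where
  "trajectory M x0 = (SOME x. is_trajectory M x0 x)"

(* If A - B ** K is Hurwitz the integrand decays exponentially, hence is integrable on {0..}. *)
definition lq_cost ::
    "real^'n^'n \<Rightarrow> real^'m^'n \<Rightarrow> real^'n^'n \<Rightarrow> real^'m^'m \<Rightarrow> real^'n \<Rightarrow> real^'n^'m \<Rightarrow> real" where
  "lq_cost A B Q R x0 K =
     integral {0..} (\<lambda>t. let x = trajectory (A - B ** K) x0 t in
       x \<bullet> (Q *v x) + (K *v x) \<bullet> (R *v (K *v x)))"

(* Riccati equation with input matrix B and cross term S. *)
definition gen_riccati ::
    "real^'n^'n \<Rightarrow> real^'k^'n \<Rightarrow> real^'n^'n \<Rightarrow> real^'k^'n \<Rightarrow> real^'k^'k \<Rightarrow> real^'n^'n \<Rightarrow> bool" where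
  "gen_riccati A B Q S R P \<longleftrightarrow>
     transpose A ** P + P ** A
       - (P ** B + S) ** matrix_inv R ** (transpose B ** P + transpose S) + Q = 0"

end

theory Submission
  imports Defs "HOL-Computational_Algebra.Fundamental_Theorem_Algebra"
begin

text \<open>
  An affine function is nonnegative on the whole space exactly when its linear part is zero and its
  constant is nonnegative. The constants of the constraints are nonnegative, so a linear feedback
  \<open>K\<close> meets the \<open>i\<close>-th constraint everywhere exactly when \<open>ell i v* K\<close> equals the row
  vector \<open>c i v* hocbf_poly A (\<alpha> i) (r i)\<close>. The first \<open>p\<close> of these equations have the particular
  solution \<open>K0\<close> and the general solution \<open>K0 + Lperp ** F\<close>; the remaining ones then hold by the
  compatibility hypothesis, since their \<open>ell i\<close> are orthogonal to the columns of \<open>Lperp\<close>. So the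
  feasible gains are the \<open>K0 + Lperp ** F\<close> with \<open>As - Bs ** F\<close> Hurwitz, and what remains is the
  unconstrained linear-quadratic regulator with data \<open>As\<close>, \<open>Bs\<close>, \<open>Qs\<close>, \<open>Ss\<close>, \<open>Rs\<close> and input
  \<open>v = - F x\<close>.

  The regulator problem is governed by two facts on a Hurwitz matrix \<open>M\<close>. Its trajectories tend to
  zero: a real polynomial that annihilates \<open>M\<close> is a product of complex linear factors, and these
  are removed one at a time, each step being a damped scalar equation or an injective linear map
  (\<open>hurwitz_trajectory_tendsto_0\<close>). Integrating a quadratic form along trajectories then shows that
  the Lyapunov equation of \<open>M\<close> is solvable (\<open>lyapunov_solution\<close>), that a symmetric matrix with
  nonpositive derivative along trajectories is positive semidefinite (\<open>lyapunov_psd\<close>), and that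
  the cost of a stabilizing feedback is the quadratic form of its Lyapunov solution
  (\<open>lyapunov_has_integral\<close>).

  For the Riccati equation, \<open>completion_of_squares\<close> rewrites the derivative of \<open>x \<bullet> P x\<close> plus the
  running cost as the form of the Riccati residual plus a square that vanishes for the feedback
  \<open>gain P\<close>. Comparing Lyapunov equations, a positive definite solution \<open>P\<close> lies below the cost
  matrix of every stabilizing feedback (\<open>solution_le_value_matrix\<close>), which gives both optimality and
  uniqueness. For existence, consider the positive semidefinite \<open>P\<close> whose residual is negative
  semidefinite. They form a closed set, and it contains the cost matrix of any stabilizing feedback.
  One step of policy iteration maps such a \<open>P\<close> to one that is no larger, and
  fixes it only if the residual is zero (\<open>policy_improvement\<close>). An element of minimal trace exists by compactness
  and must be fixed.
\<close>

section \<open>Trajectories of a linear system\<close>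

lemma mat_pow_mult_vector_Suc: "mat_pow M (Suc k) *v v = M *v (mat_pow M k *v v)"
  by (simp add: matrix_vector_mul_assoc)

text \<open>The operator norm bound that makes the exponential series of a matrix converge.\<close>
lemma norm_mat_pow_bound:
  fixes M :: "real^'n^'n"
  obtains b where "b > 0" "\<And>k v. norm (mat_pow M k *v v) \<le> b ^ k * norm v"
proof -
  obtain b where b: "b > 0" "\<And>v. norm (M *v v) \<le> b * norm v"
    using linear_bounded_pos[OF matrix_vector_mul_linear[of M]] by auto
  have "norm (mat_pow M k *v v) \<le> b ^ k * norm v" for k v
  proof (induction k)
    case (Suc k)
    have "norm (mat_pow M (Suc k) *v v) \<le> b * norm (mat_pow M k *v v)"
      unfolding mat_pow_mult_vector_Suc by (rule b(2))
    also have "\<dots> \<le> b * (b ^ k * norm v)"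
      using Suc b(1) by (intro mult_left_mono) auto
    finally show ?case by simp
  qed simp
  with b(1) that show ?thesis by blast
qed

lemma has_vector_derivative_vec:
  fixes f :: "real \<Rightarrow> real^'n"
  assumes "\<And>i. ((\<lambda>t. f t $ i) has_real_derivative f' $ i) (at t within S)"
  shows "(f has_vector_derivative f') (at t within S)"
  unfolding has_vector_derivative_def
proof (subst has_derivative_componentwise_within, intro ballI)
  fix b :: "real^'n" assume "b \<in> Basis"
  then obtain i where b: "b = axis i 1" by (auto simp: Basis_vec_def)
  have "((\<lambda>t. f t $ i) has_derivative (\<lambda>h. h * f' $ i)) (at t within S)"
    using assms[of i] by (simp add: has_field_derivative_def mult_commute_abs)
  then show "((\<lambda>x. f x \<bullet> b) has_derivative (\<lambda>x. x *\<^sub>R f' \<bullet> b)) (at t within S)"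
    by (simp add: b inner_axis)
qed

text \<open>The exponential series, taken componentwise: each component is a scalar power series, dominated by
  the series of \<open>exp (b * \<bar>t\<bar>)\<close>, and may be differentiated term by term.\<close>
lemma trajectory_exists:
  fixes M :: "real^'n^'n"
  shows "\<exists>x. is_trajectory M x0 x"
proof -
  obtain b where b: "b > 0" "\<And>k v. norm (mat_pow M k *v v) \<le> b ^ k * norm v"
    using norm_mat_pow_bound by blast
  define w where "w k = mat_pow M k *v x0" for k
  define cf where "cf i k = w k $ i / fact k" for i k
  have summ: "summable (\<lambda>k. cf i k * t ^ k)" for i and t :: real
  proof (rule summable_comparison_test')
    have "summable (\<lambda>k. (b * \<bar>t\<bar>) ^ k /\<^sub>R fact k)"
      by (rule sums_summable[OF exp_converges])
    then show "summable (\<lambda>k. norm x0 * ((b * \<bar>t\<bar>) ^ k /\<^sub>R fact k))"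
      by (rule summable_mult)
    fix k :: nat
    have "\<bar>w k $ i\<bar> \<le> b ^ k * norm x0"
      using component_le_norm_cart[of "w k" i] b(2)[of k x0] by (simp add: w_def)
    then have "\<bar>w k $ i\<bar> * \<bar>t\<bar> ^ k \<le> b ^ k * norm x0 * \<bar>t\<bar> ^ k"
      by (rule mult_right_mono) simp
    then show "norm (cf i k * t ^ k) \<le> norm x0 * ((b * \<bar>t\<bar>) ^ k /\<^sub>R fact k)"
      by (simp add: cf_def abs_mult power_abs field_simps)
  qed
  have diffs_cf: "diffs (cf i) k = (\<Sum>j\<in>UNIV. M $ i $ j * cf j k)" for i k
  proof -
    have "w (Suc k) $ i = (\<Sum>j\<in>UNIV. M $ i $ j * w k $ j)"
      unfolding w_def mat_pow_mult_vector_Suc by (simp add: matrix_vector_mult_def)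
    moreover have "diffs (cf i) k = w (Suc k) $ i / fact k"
      by (simp add: diffs_def cf_def del: of_nat_Suc)
    ultimately show ?thesis by (simp add: cf_def sum_divide_distrib)
  qed
  define x where "x t = (\<chi> i. \<Sum>k. cf i k * t ^ k)" for t :: real
  have deriv: "((\<lambda>t. x t $ i) has_real_derivative (M *v x t) $ i) (at t)" for i t
  proof -
    have "((\<lambda>t. x t $ i) has_real_derivative (\<Sum>k. diffs (cf i) k * t ^ k)) (at t)"
      using termdiffs_strong_converges_everywhere[OF summ] by (simp add: x_def)
    moreover have "(\<Sum>k. diffs (cf i) k * t ^ k) = (M *v x t) $ i"
    proof -
      have "(\<Sum>k. diffs (cf i) k * t ^ k) = (\<Sum>k. \<Sum>j\<in>UNIV. M $ i $ j * (cf j k * t ^ k))"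
        by (simp add: diffs_cf sum_distrib_right mult.assoc)
      also have "\<dots> = (\<Sum>j\<in>UNIV. \<Sum>k. M $ i $ j * (cf j k * t ^ k))"
        by (intro suminf_sum summable_mult summ)
      also have "\<dots> = (\<Sum>j\<in>UNIV. M $ i $ j * (\<Sum>k. cf j k * t ^ k))"
        by (simp add: suminf_mult[OF summ])
      finally show ?thesis by (simp add: x_def matrix_vector_mult_def)
    qed
    ultimately show ?thesis by simp
  qed
  have "x 0 = x0"
    by (simp add: x_def vec_eq_iff powser_zero[of "cf _"]) (simp add: cf_def w_def)
  moreover have "(x has_vector_derivative M *v x t) (at t within {0..})" for t
    by (rule has_vector_derivative_vec) (use deriv in \<open>blast intro: has_field_derivative_at_within\<close>)
  ultimately show ?thesis unfolding is_trajectory_def by blast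
qed

lemma trajectory_is_trajectory: "is_trajectory M x0 (trajectory M x0)"
  unfolding trajectory_def by (rule someI_ex[OF trajectory_exists])

lemma is_trajectory_initial: "is_trajectory M x0 x \<Longrightarrow> x 0 = x0"
  by (simp add: is_trajectory_def)

lemma is_trajectory_deriv:
  "is_trajectory M x0 x \<Longrightarrow> t \<ge> 0 \<Longrightarrow> (x has_vector_derivative M *v x t) (at t within {0..})"
  by (simp add: is_trajectory_def)

section \<open>Decay of the trajectories of a Hurwitz matrix\<close>

text \<open>Trajectories are differentiable only within \<open>{0..}\<close>, so the fundamental theorem of calculus is
  needed for one-sided derivatives at 0.\<close>
lemma ftc_nonneg_axis:
  fixes f :: "real \<Rightarrow> real"
  assumes "\<And>t. t \<ge> 0 \<Longrightarrow> (f has_real_derivative f' t) (at t within {0..})"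
    and "0 \<le> a" "a \<le> b"
  shows "(f' has_integral f b - f a) {a..b}"
proof (rule fundamental_theorem_of_calculus[OF \<open>a \<le> b\<close>])
  fix t assume "t \<in> {a..b}"
  then have "(f has_real_derivative f' t) (at t within {0..})"
    using assms by auto
  then have "(f has_real_derivative f' t) (at t within {a..b})"
    by (rule DERIV_subset) (use assms in auto)
  then show "(f has_vector_derivative f' t) (at t within {a..b})"
    by (simp add: has_real_derivative_iff_has_vector_derivative)
qed

text \<open>Once \<open>w\<close> stays below \<open>a * e\<close>, the function \<open>exp (a * t) * (v t - e)\<close> is nonincreasing,
  so \<open>v\<close> exceeds \<open>e\<close> by at most an exponentially decaying amount.\<close>
lemma tendsto_0_of_differential_inequality:
  fixes v w v' :: "real \<Rightarrow> real"
  assumes deriv: "\<And>t. t \<ge> 0 \<Longrightarrow> (v has_real_derivative v' t) (at t within {0..})"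
    and le: "\<And>t. t \<ge> 0 \<Longrightarrow> v' t \<le> - a * v t + w t"
    and "a > 0" and w: "(w \<longlongrightarrow> 0) at_top" and nonneg: "\<And>t. v t \<ge> 0"
  shows "(v \<longlongrightarrow> 0) at_top"
proof (rule tendstoI)
  fix e' :: real assume "e' > 0"
  \<comment> \<open>The other half of \<open>e'\<close> is left for the exponentially decaying part.\<close>
  define e where "e = e' / 2"
  have "e > 0" "e < e'" using \<open>e' > 0\<close> by (auto simp: e_def)
  have "eventually (\<lambda>t. w t < a * e) at_top"
    using order_tendstoD(2)[OF w] \<open>a > 0\<close> \<open>e > 0\<close> by simp
  then obtain T0 where "\<And>t. t \<ge> T0 \<Longrightarrow> w t < a * e"
    by (auto simp: eventually_at_top_linorder)
  then obtain T where T: "T \<ge> 0" "\<And>t. t \<ge> T \<Longrightarrow> w t < a * e"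
    using that[of "max 0 T0"] by auto
  define \<phi> where "\<phi> t = exp (a * t) * (v t - e)" for t
  define \<phi>' where "\<phi>' t = exp (a * t) * a * (v t - e) + exp (a * t) * v' t" for t
  have \<phi>_deriv: "(\<phi> has_real_derivative \<phi>' t) (at t within {0..})" if "t \<ge> 0" for t
    unfolding \<phi>_def[abs_def] \<phi>'_def using deriv[OF that]
    by (auto intro!: derivative_eq_intros)
  have \<phi>_le: "\<phi> t \<le> \<phi> T" if "t \<ge> T" for t
  proof -
    have "(\<phi>' has_integral \<phi> t - \<phi> T) {T..t}"
      by (rule ftc_nonneg_axis[OF \<phi>_deriv]) (use T that in auto)
    moreover have "\<phi>' s \<le> 0" if "s \<in> {T..t}" for s
    proof -
      have "v' s \<le> - a * v s + a * e"
        using le[of s] T(1) T(2)[of s] that by auto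
      then have "exp (a * s) * (a * (v s - e) + v' s) \<le> 0"
        by (intro mult_nonneg_nonpos) (auto simp: algebra_simps)
      then show ?thesis by (simp add: \<phi>'_def algebra_simps)
    qed
    ultimately have "\<phi> t - \<phi> T \<le> 0"
      using has_integral_le[OF _ has_integral_0] by blast
    then show ?thesis by simp
  qed
  have "((\<lambda>t. e + \<phi> T * exp (- (a * t))) \<longlongrightarrow> e + \<phi> T * 0) at_top"
    by (intro tendsto_intros filterlim_compose[OF exp_at_bot] filterlim_compose[OF filterlim_uminus_at_bot_at_top]
        filterlim_tendsto_pos_mult_at_top[OF tendsto_const \<open>a > 0\<close> filterlim_ident])
  then have "eventually (\<lambda>t. e + \<phi> T * exp (- (a * t)) < e') at_top"
    using order_tendstoD(2) \<open>e < e'\<close> by fastforce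
  then show "eventually (\<lambda>t. dist (v t) 0 < e') at_top"
    using eventually_ge_at_top[of T]
  proof eventually_elim
    case (elim t)
    have "exp (- (a * t)) * \<phi> t \<le> exp (- (a * t)) * \<phi> T"
      using \<phi>_le elim by (intro mult_left_mono) auto
    moreover have "exp (- (a * t)) * \<phi> t = v t - e"
      by (simp add: \<phi>_def mult.assoc[symmetric] flip: exp_add)
    ultimately have "v t < e'"
      using elim(1) by (metis add.commute diff_le_eq dual_order.strict_trans2 mult.commute not_le)
    then show ?case using nonneg[of t] by simp
  qed
qed

text \<open>With \<open>a = - Re z\<close>, the squared norm of \<open>g\<close> has derivative at most
  \<open>- a * (norm g)\<^sup>2 + (norm h)\<^sup>2 / a\<close>: half of the damping absorbs the mixed term.\<close>
lemma forced_scalar_decay: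
  fixes g h :: "real \<Rightarrow> complex"
  assumes g: "\<And>t. t \<ge> 0 \<Longrightarrow> (g has_vector_derivative z * g t + h t) (at t within {0..})"
    and h: "(h \<longlongrightarrow> 0) at_top" and z: "Re z < 0"
  shows "(g \<longlongrightarrow> 0) at_top"
proof -
  define a where "a = - Re z"
  have a: "a > 0" using z by (simp add: a_def)
  have "((\<lambda>t. g t \<bullet> g t) \<longlongrightarrow> 0) at_top"
  proof (rule tendsto_0_of_differential_inequality[where w = "\<lambda>t. (norm (h t))\<^sup>2 / a" and a = a])
    fix t :: real assume "t \<ge> 0"
    from g[OF this]
    have "((\<lambda>t. g t \<bullet> g t) has_vector_derivative g t \<bullet> (z * g t + h t) + (z * g t + h t) \<bullet> g t) (at t within {0..})"
      using bounded_bilinear.has_vector_derivative[OF bounded_bilinear_inner] by blast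
    then show "((\<lambda>t. g t \<bullet> g t) has_real_derivative 2 * (g t \<bullet> (z * g t + h t))) (at t within {0..})"
      by (simp add: has_real_derivative_iff_has_vector_derivative inner_commute)
    have 1: "g t \<bullet> (z * g t) = - a * (g t \<bullet> g t)"
      by (simp add: inner_complex_def a_def algebra_simps)
    have 2: "2 * (g t \<bullet> h t) \<le> a * (g t \<bullet> g t) + (norm (h t))\<^sup>2 / a"
    proof -
      have "0 \<le> (norm (a *\<^sub>R g t - h t))\<^sup>2" by simp
      also have "\<dots> = a\<^sup>2 * (g t \<bullet> g t) - 2 * a * (g t \<bullet> h t) + (norm (h t))\<^sup>2"
        unfolding power2_norm_eq_inner
        by (simp add: inner_diff_left inner_diff_right inner_commute power2_eq_square algebra_simps)
      finally show ?thesis using a by (simp add: field_simps power2_eq_square)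
    qed
    show "2 * (g t \<bullet> (z * g t + h t)) \<le> - a * (g t \<bullet> g t) + (norm (h t))\<^sup>2 / a"
      using 1 2 by (simp add: inner_add_right)
  next
    show "((\<lambda>t. (norm (h t))\<^sup>2 / a) \<longlongrightarrow> 0) at_top"
      using a h by (auto intro!: tendsto_eq_intros)
  qed (use a in auto)
  then have "((\<lambda>t. sqrt (g t \<bullet> g t)) \<longlongrightarrow> sqrt 0) at_top"
    by (rule tendsto_real_sqrt)
  then have "((\<lambda>t. norm (g t)) \<longlongrightarrow> 0) at_top"
    by (simp add: norm_eq_sqrt_inner)
  then show ?thesis by (rule tendsto_norm_zero_cancel)
qed

text \<open>The vector \<open>p(T) v\<close>, by Horner's scheme. No matrix \<open>p(T)\<close> is formed, because the ring
  operations on the matrix type act entrywise.\<close>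
definition poly_apply :: "'a::comm_ring_1 poly \<Rightarrow> 'a^'n^'n \<Rightarrow> 'a^'n \<Rightarrow> 'a^'n" where
  "poly_apply p T v = fold_coeffs (\<lambda>a w. a *s v + T *v w) p 0"

lemma poly_apply_0 [simp]: "poly_apply 0 T v = 0"
  by (simp add: poly_apply_def)

lemma poly_apply_pCons [simp]: "poly_apply (pCons a p) T v = a *s v + T *v poly_apply p T v"
  by (cases "p = 0 \<and> a = 0") (auto simp: poly_apply_def)

lemma poly_apply_add: "poly_apply (p + q) T v = poly_apply p T v + poly_apply q T v"
  by (induction p q rule: poly_induct2)
    (simp_all add: algebra_simps matrix_vector_right_distrib vector_sadd_rdistrib)

lemma poly_apply_sum: "poly_apply (\<Sum>k\<in>K. f k) T v = (\<Sum>k\<in>K. poly_apply (f k) T v)"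
  by (induction K rule: infinite_finite_induct) (simp_all add: poly_apply_add)

lemma poly_apply_monom:
  "poly_apply (monom a k) M v = a *\<^sub>R (mat_pow M k *v v)"
  by (induction k) (simp_all add: monom_0 monom_Suc scalar_mult_eq_scaleR
      matrix_vector_mult_scaleR mat_pow_mult_vector_Suc del: mat_pow.simps(2))

lemma matrix_vector_mult_smult: "T *v (a *s v) = a *s (T *v v)" for a :: "'a::comm_ring_1"
  by (simp add: vec_eq_iff matrix_vector_mult_def sum_distrib_left mult.left_commute)

text \<open>The factor is applied to the vector first, so that a trajectory \<open>g\<close> is turned into the
  trajectory \<open>T g - z g\<close> before the cofactor acts.\<close>
lemma poly_apply_linear_factor:
  "poly_apply ([:-z, 1:] * q) T v = poly_apply q T (T *v v - z *s v)"
proof -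
  have smult: "poly_apply (smult a q) T v = a *s poly_apply q T v" for a q
    by (induction q) (simp_all add: vector_add_ldistrib vector_smult_assoc matrix_vector_mult_smult)
  have "poly_apply q T (T *v v - z *s v) = T *v poly_apply q T v - z *s poly_apply q T v"
  proof (induction q)
    case (pCons a q)
    show ?case
      by (simp add: pCons.IH vector_add_ldistrib vector_ssub_ldistrib matrix_vector_right_distrib
        matrix_vector_mult_diff_distrib matrix_vector_mult_smult vector_smult_assoc mult.commute)
  qed simp
  moreover have "[:-z, 1:] * q = pCons 0 q + smult (- z) q" by simp
  ultimately show ?thesis
    by (simp add: smult poly_apply_add vector_smult_lneg del: smult_minus_left mult_pCons_left)
qed

text \<open>Transfers annihilation by a real polynomial to the complexified matrix, where the polynomial splits.\<close>
lemma poly_apply_map_complex: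
  "poly_apply (map_poly complex_of_real p) (map_matrix complex_of_real M) (\<chi> i. complex_of_real (v $ i))
     = (\<chi> i. complex_of_real (poly_apply p M v $ i))"
  by (induction p) (simp_all add: map_poly_pCons vec_eq_iff matrix_vector_mult_def)

text \<open>The powers \<open>mat_pow M 0, \<dots>, mat_pow M N\<close> are too many for the dimension \<open>N\<close> of the matrix
  space: they are linearly dependent, or two of them coincide.\<close>
lemma annihilating_polynomial:
  fixes M :: "real^'n^'n"
  obtains p :: "real poly" where "p \<noteq> 0" "\<And>v. poly_apply p M v = 0"
proof -
  define N where "N = DIM(real^'n^'n)"
  obtain a k0 where a: "k0 \<le> N" "a k0 \<noteq> 0" "(\<Sum>k\<le>N. a k *\<^sub>R mat_pow M k) = 0"
  proof (cases "inj_on (mat_pow M) {..N}")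
    case True
    have "card (mat_pow M ` {..N}) = Suc N" using card_image[OF True] by simp
    then have "dependent (mat_pow M ` {..N})"
      by (intro dependent_biggerset) (simp only: N_def)
    then obtain u B where u: "B \<in> mat_pow M ` {..N}" "u B \<noteq> 0"
        "(\<Sum>C\<in>mat_pow M ` {..N}. u C *\<^sub>R C) = 0"
      by (subst (asm) dependent_finite) auto
    show ?thesis
      using u that[of _ "u \<circ> mat_pow M"] by (auto simp: sum.reindex[OF True] o_def)
  next
    case False
    then obtain i j where ij: "i \<le> N" "j \<le> N" "i \<noteq> j" "mat_pow M i = mat_pow M j"
      by (auto simp: inj_on_def)
    define a :: "nat \<Rightarrow> real" where "a k = (if k = i then 1 else if k = j then - 1 else 0)" for k
    have "(\<Sum>k\<le>N. a k *\<^sub>R mat_pow M k) = (\<Sum>k\<in>{i, j}. a k *\<^sub>R mat_pow M k)"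
      by (rule sum.mono_neutral_right) (use ij in \<open>auto simp: a_def\<close>)
    also have "\<dots> = 0" using ij by (simp add: a_def)
    finally show ?thesis using that[of i a] ij by (simp add: a_def)
  qed
  define p where "p = (\<Sum>k\<le>N. monom (a k) k)"
  have "coeff p k0 = a k0"
    using a(1) by (simp add: p_def coeff_sum)
  then have "p \<noteq> 0" using a(2) by auto
  moreover have "poly_apply p M v = 0" for v
  proof -
    have "poly_apply p M v = (\<Sum>k\<le>N. (a k *\<^sub>R mat_pow M k) *v v)"
      by (simp add: p_def poly_apply_sum poly_apply_monom scaleR_matrix_vector_assoc)
    also have "\<dots> = (\<Sum>k\<le>N. a k *\<^sub>R mat_pow M k) *v v"
      by (induction N) (simp_all add: matrix_vector_mult_add_rdistrib)
    finally show ?thesis by (simp add: a(3))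
  qed
  ultimately show ?thesis using that by blast
qed

lemma linear_shifted:
  "linear (\<lambda>v. (T :: complex^'n^'n) *v v - z *s v)"
  by (rule linearI) (simp_all add: matrix_vector_right_distrib vector_add_ldistrib vec_eq_iff
      matrix_vector_mult_def scaleR_sum_right algebra_simps sum.distrib)

text \<open>If \<open>z\<close> is an eigenvalue then \<open>Re z < 0\<close>, and every component solves a damped scalar equation
  with forcing that tends to zero. Otherwise \<open>T - z\<close> is injective, hence bounded below.\<close>
lemma decay_through_linear_factor:
  fixes M :: "real^'n^'n" and g :: "real \<Rightarrow> complex^'n"
  defines "T \<equiv> map_matrix complex_of_real M"
  assumes hur: "hurwitz M"
    and g: "\<And>t. t \<ge> 0 \<Longrightarrow> (g has_vector_derivative T *v g t) (at t within {0..})"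
    and lim: "((\<lambda>t. T *v g t - z *s g t) \<longlongrightarrow> 0) at_top"
  shows "(g \<longlongrightarrow> 0) at_top"
proof (cases "\<exists>v. v \<noteq> 0 \<and> T *v v = z *s v")
  case True
  then have z: "Re z < 0"
    using hur unfolding hurwitz_def T_def by blast
  have "((\<lambda>t. g t $ i) \<longlongrightarrow> 0) at_top" for i
  proof (rule forced_scalar_decay[OF _ _ z])
    show "((\<lambda>t. (T *v g t - z *s g t) $ i) \<longlongrightarrow> 0) at_top"
      using tendsto_vec_nth[OF lim, of i] by simp
    show "((\<lambda>t. g t $ i) has_vector_derivative z * g t $ i + (T *v g t - z *s g t) $ i) (at t within {0..})"
      if "t \<ge> 0" for t
      using bounded_linear.has_vector_derivative[OF bounded_linear_vec_nth g[OF that], of i] by simp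
  qed
  then show ?thesis by (intro vec_tendstoI) simp
next
  case False
  have "inj (\<lambda>v. T *v v - z *s v)"
    unfolding linear_injective_0[OF linear_shifted] using False by auto
  then obtain B where B: "B > 0" "\<And>v. B * norm v \<le> norm (T *v v - z *s v)"
    using linear_inj_bounded_below_pos[OF linear_shifted] by blast
  have "((\<lambda>t. norm (T *v g t - z *s g t) / B) \<longlongrightarrow> 0) at_top"
    using tendsto_divide[OF tendsto_norm[OF lim] tendsto_const, of B] B(1) by simp
  then show ?thesis
    by (rule Lim_null_comparison[rotated])
      (use B in \<open>auto intro!: always_eventually simp: field_simps\<close>)
qed

text \<open>Split off one linear factor at a time; \<open>T g - z g\<close> is again a solution, annihilated in the limit
  by a polynomial of smaller degree.\<close>
lemma decay_of_annihilated_solution: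
  fixes M :: "real^'n^'n" and g :: "real \<Rightarrow> complex^'n"
  defines "T \<equiv> map_matrix complex_of_real M"
  assumes hur: "hurwitz M" and "p \<noteq> 0"
    and "\<And>t. t \<ge> 0 \<Longrightarrow> (g has_vector_derivative T *v g t) (at t within {0..})"
    and "((\<lambda>t. poly_apply p T (g t)) \<longlongrightarrow> 0) at_top"
  shows "(g \<longlongrightarrow> 0) at_top"
  using assms(3-)
proof (induction "degree p" arbitrary: p g)
  case 0
  then obtain a where a: "p = [:a:]" "a \<noteq> 0"
    by (metis degree_eq_zeroE pCons_0_0)
  have "((\<lambda>t. a * g t $ i) \<longlongrightarrow> 0) at_top" for i
    using tendsto_vec_nth[OF "0.prems"(3), of i] by (simp add: a)
  then have "((\<lambda>t. g t $ i) \<longlongrightarrow> 0) at_top" for i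
    using tendsto_mult_left_iff[OF a(2), of "\<lambda>t. g t $ i" 0 at_top] by simp
  then show ?case by (intro vec_tendstoI) simp
next
  case (Suc n)
  have "\<not> constant (poly p)"
    using Suc.hyps(2) by (simp add: constant_degree)
  then obtain z where "poly p z = 0"
    using fundamental_theorem_of_algebra by blast
  then obtain q where q: "p = [:-z, 1:] * q"
    by (auto simp: poly_eq_0_iff_dvd dvd_def)
  have "q \<noteq> 0" using q Suc.prems(1) by auto
  have "n = degree q"
    using Suc.hyps(2) \<open>q \<noteq> 0\<close> by (subst (asm) q, subst (asm) degree_mult_eq) auto
  define h where "h t = T *v g t - z *s g t" for t
  have "(h has_vector_derivative T *v h t) (at t within {0..})" if "t \<ge> 0" for t
  proof -
    have "bounded_linear (\<lambda>v. T *v v - z *s v)"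
      using linear_shifted by (simp add: linear_linear)
    from bounded_linear.has_vector_derivative[OF this Suc.prems(2)[OF that]]
    show ?thesis
      by (simp add: h_def[abs_def] matrix_vector_mult_diff_distrib matrix_vector_mult_smult)
  qed
  moreover have "((\<lambda>t. poly_apply q T (h t)) \<longlongrightarrow> 0) at_top"
    using Suc.prems(3) by (simp only: q poly_apply_linear_factor h_def)
  ultimately have "(h \<longlongrightarrow> 0) at_top"
    using Suc.hyps(1)[OF \<open>n = degree q\<close> \<open>q \<noteq> 0\<close>] by blast
  then show ?case
    using decay_through_linear_factor[OF hur, of g z] Suc.prems(2) by (simp add: h_def[abs_def] T_def)
qed

theorem hurwitz_trajectory_tendsto_0:
  fixes M :: "real^'n^'n"
  assumes hur: "hurwitz M" and x: "is_trajectory M x0 x"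
  shows "(x \<longlongrightarrow> 0) at_top"
proof -
  define cv :: "real^'n \<Rightarrow> complex^'n" where "cv v = (\<chi> i. complex_of_real (v $ i))" for v
  have lin: "bounded_linear cv"
    unfolding linear_conv_bounded_linear[symmetric] by (rule linearI) (simp_all add: cv_def vec_eq_iff scaleR_conv_of_real[where 'a = complex])
  have cv_mult: "cv (M *v v) = map_matrix complex_of_real M *v cv v" for v
    by (simp add: cv_def vec_eq_iff matrix_vector_mult_def)
  obtain p :: "real poly" where p: "p \<noteq> 0" "\<And>v. poly_apply p M v = 0"
    using annihilating_polynomial by blast
  have "((\<lambda>t. cv (x t)) \<longlongrightarrow> 0) at_top"
  proof (rule decay_of_annihilated_solution[OF hur])
    show "map_poly complex_of_real p \<noteq> 0" using p(1) by (simp add: map_poly_eq_0_iff)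
    show "((\<lambda>t. cv (x t)) has_vector_derivative map_matrix complex_of_real M *v cv (x t)) (at t within {0..})"
      if "t \<ge> 0" for t
      using bounded_linear.has_vector_derivative[OF lin is_trajectory_deriv[OF x that]]
      by (simp add: cv_mult)
    show "((\<lambda>t. poly_apply (map_poly complex_of_real p) (map_matrix complex_of_real M) (cv (x t))) \<longlongrightarrow> 0) at_top"
      unfolding cv_def poly_apply_map_complex by (simp add: p(2) zero_vec_def)
  qed
  then have "((\<lambda>t. complex_of_real (x t $ i)) \<longlongrightarrow> 0) at_top" for i
    using tendsto_vec_nth[of "\<lambda>t. cv (x t)" 0 at_top i] by (simp add: cv_def)
  then have "((\<lambda>t. x t $ i) \<longlongrightarrow> 0) at_top" for i
    using tendsto_of_real_iff[of "\<lambda>t. x t $ i" 0 at_top, where ?'a = complex] by simp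
  then show ?thesis by (intro vec_tendstoI) simp
qed

section \<open>Quadratic forms and congruences\<close>

lemma transpose_add: "transpose (X + Y) = transpose X + transpose Y"
  by (simp add: transpose_def vec_eq_iff)

lemma transpose_diff: "transpose (X - Y) = transpose X - transpose Y" for X :: "real^'n^'m"
  by (simp add: transpose_def vec_eq_iff)

lemma matrix_vector_mult_uminus: "(- X) *v v = - (X *v v)" for X :: "real^'n^'m"
  using matrix_vector_mult_diff_rdistrib[of 0 X v] by simp

lemma matrix_vector_mult_neg: "X *v (- v) = - (X *v v)" for X :: "real^'n^'m"
  using matrix_vector_mult_diff_distrib[of X 0 v] by simp

lemma symmetric_matrix_inner:
  fixes D :: "real^'n^'n"
  assumes "transpose D = D"
  shows "(D *v x) \<bullet> y = x \<bullet> (D *v y)"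
  using assms by (metis dot_lmul_matrix transpose_matrix_vector)

lemma matrix_eqI_bilinear:
  fixes D E :: "real^'n^'m"
  assumes "\<And>x y. x \<bullet> (D *v y) = x \<bullet> (E *v y)"
  shows "D = E"
  unfolding matrix_eq using assms by (metis vector_eq_ldot)

lemma symmetric_matrix_eqI_quadratic:
  fixes D E :: "real^'n^'n"
  assumes "transpose D = D" "transpose E = E" "\<And>x. x \<bullet> (D *v x) = x \<bullet> (E *v x)"
  shows "D = E"
proof (rule matrix_eqI_bilinear)
  fix x y
  show "x \<bullet> (D *v y) = x \<bullet> (E *v y)"
    using assms(3)[of "x + y"] assms(3)[of x] assms(3)[of y]
      symmetric_matrix_inner[OF assms(1), of x y] symmetric_matrix_inner[OF assms(2), of x y]
    by (simp add: matrix_vector_right_distrib inner_add_left inner_add_right inner_commute)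
qed

text \<open>Otherwise the form would become negative at \<open>x + s D x\<close> for a small \<open>s < 0\<close>.\<close>
lemma psd_isotropic_in_kernel:
  fixes D :: "real^'n^'n"
  assumes sym: "transpose D = D" and psd: "\<And>x. 0 \<le> x \<bullet> (D *v x)" and x: "x \<bullet> (D *v x) = 0"
  shows "D *v x = 0"
proof (rule ccontr)
  assume nz: "D *v x \<noteq> 0"
  define y where "y = D *v x"
  define n c where "n = y \<bullet> y" and "c = y \<bullet> (D *v y)"
  have n: "n > 0" using nz by (simp add: n_def y_def)
  have c: "c \<ge> 0" using psd by (simp add: c_def)
  define s where "s = - n / (c + 1)"
  have expand: "(x + s *\<^sub>R y) \<bullet> (D *v (x + s *\<^sub>R y)) = s * (2 * n + s * c)"
    using x symmetric_matrix_inner[OF sym, of x y]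
    by (simp add: matrix_vector_right_distrib matrix_vector_mult_scaleR inner_add_left inner_add_right
        inner_commute n_def c_def y_def[symmetric] algebra_simps)
  have "2 * n + s * c = n * (c + 2) / (c + 1)"
    using c by (simp add: s_def field_simps)
  also have "\<dots> > 0" using n c by simp
  finally have "2 * n + s * c > 0" .
  moreover have "s < 0" using n c by (simp add: s_def)
  ultimately have "s * (2 * n + s * c) < 0" by (rule mult_neg_pos[rotated])
  with expand psd[of "x + s *\<^sub>R y"] show False by simp
qed

lemma matrix_entry_inner: "(X :: real^'n^'n) $ i $ j = axis i 1 \<bullet> (X *v axis j 1)"
  by (simp add: inner_axis' matrix_vector_mult_basis column_def)

text \<open>Evaluating the form at \<open>e\<^sub>i + e\<^sub>j\<close> and \<open>e\<^sub>i - e\<^sub>j\<close> bounds every entry by diagonal ones. This yields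
  the compactness used for the Riccati equation.\<close>
lemma psd_norm_le_trace:
  fixes X :: "real^'n^'n"
  assumes sym: "transpose X = X" and psd: "\<And>x. 0 \<le> x \<bullet> (X *v x)"
  shows "norm X \<le> real (CARD('n)\<^sup>2) * trace X"
proof -
  have diag: "0 \<le> X $ i $ i" for i
    using psd[of "axis i 1"] by (simp add: matrix_entry_inner)
  have diag_le: "X $ i $ i \<le> trace X" for i
    unfolding trace_def by (rule member_le_sum) (auto simp: diag)
  have entry: "\<bar>X $ i $ j\<bar> \<le> trace X" for i j
  proof -
    have "(axis i 1 + s *\<^sub>R axis j 1) \<bullet> (X *v (axis i 1 + s *\<^sub>R axis j 1))
        = X $ i $ i + 2 * s * X $ i $ j + s\<^sup>2 * X $ j $ j" for s
      using symmetric_matrix_inner[OF sym, of "axis i 1" "axis j 1"]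
      by (simp add: matrix_vector_right_distrib matrix_vector_mult_scaleR inner_add_left inner_add_right
          matrix_entry_inner inner_commute power2_eq_square algebra_simps)
    from psd[of "axis i 1 + 1 *\<^sub>R axis j 1", unfolded this] psd[of "axis i 1 + (-1) *\<^sub>R axis j 1", unfolded this]
    show ?thesis using diag_le[of i] diag_le[of j] by simp
  qed
  have "norm X \<le> (\<Sum>i\<in>UNIV. norm (X $ i))"
    unfolding norm_vec_def by (rule L2_set_le_sum) simp
  also have "\<dots> \<le> (\<Sum>i\<in>UNIV. \<Sum>j\<in>UNIV. \<bar>X $ i $ j\<bar>)"
    by (intro sum_mono norm_le_l1_cart)
  also have "\<dots> \<le> (\<Sum>i\<in>(UNIV :: 'n set). \<Sum>j\<in>(UNIV :: 'n set). trace X)"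
    by (intro sum_mono entry)
  finally show ?thesis by (simp add: power2_eq_square)
qed

lemma sym_pos_def_inverse:
  fixes R :: "real^'k^'k"
  assumes R: "sym_pos_def R"
  shows "R ** matrix_inv R = mat 1" "matrix_inv R ** R = mat 1"
    "transpose (matrix_inv R) = matrix_inv R"
proof -
  have "x = 0" if "R *v x = 0" for x
    using R that unfolding sym_pos_def_def by (metis inner_zero_right less_irrefl)
  then have "invertible R"
    by (simp add: invertible_left_inverse matrix_left_invertible_ker)
  then show *: "R ** matrix_inv R = mat 1" "matrix_inv R ** R = mat 1"
    unfolding invertible_def matrix_inv_def by (metis (mono_tags, lifting) someI_ex)+
  have "transpose (matrix_inv R) ** R = mat 1"
    using arg_cong[OF *(1), of transpose] R by (simp add: matrix_transpose_mul sym_pos_def_def)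
  then show "transpose (matrix_inv R) = matrix_inv R"
    using *(1) by (metis matrix_mul_assoc matrix_mul_lid matrix_mul_rid)
qed

lemma inner_congruence:
  fixes X :: "real^'k^'m" and Y :: "real^'l^'m"
  shows "x \<bullet> ((transpose X ** R ** Y) *v y) = (X *v x) \<bullet> (R *v (Y *v y))"
  by (simp add: matrix_vector_mul_assoc[symmetric] inner_commute[of x] dot_lmul_matrix)
    (simp add: inner_commute)

lemma sym_pos_def_congruence:
  fixes X :: "real^'k^'m"
  assumes R: "sym_pos_def R" and ker: "\<And>y. X *v y = 0 \<Longrightarrow> y = 0"
  shows "sym_pos_def (transpose X ** R ** X)"
proof -
  show ?thesis
    using R ker by (auto simp: inner_congruence sym_pos_def_def matrix_transpose_mul matrix_mul_assoc)
qed

lemma independent_columns_kernel: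
  fixes X :: "real^'k^'m"
  assumes inj: "inj (\<lambda>j. column j X)" and ind: "independent (columns X)" and y: "X *v y = 0"
  shows "y = 0"
proof (rule ccontr)
  assume "y \<noteq> 0"
  then obtain k where k: "y $ k \<noteq> 0" by (auto simp: vec_eq_iff)
  define u where "u v = y $ the_inv (\<lambda>j. column j X) v" for v
  have u: "u (column j X) = y $ j" for j
    by (simp add: u_def the_inv_f_f[OF inj])
  have cols: "columns X = range (\<lambda>j. column j X)" by (auto simp: columns_def)
  then have "finite (columns X)" by simp
  have "(\<Sum>v\<in>columns X. u v *\<^sub>R v) = (\<Sum>j\<in>UNIV. y $ j *\<^sub>R column j X)"
    unfolding cols by (simp add: sum.reindex[OF inj] u)
  also have "\<dots> = 0"
    using y by (simp add: matrix_mult_sum scalar_mult_eq_scaleR)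
  finally have "dependent (columns X)"
    unfolding dependent_finite[OF \<open>finite (columns X)\<close>] using k u[of k]
    by (intro exI[of _ u]) (auto simp: cols intro!: exI[of _ k])
  with ind show False by simp
qed

lemma affine_nonneg_everywhere_iff:
  "(\<forall>x :: real^'n. 0 \<le> w \<bullet> x + b) \<longleftrightarrow> w = 0 \<and> 0 \<le> b"
proof
  assume *: "\<forall>x. 0 \<le> w \<bullet> x + b"
  have "w = 0"
  proof (rule ccontr)
    assume "w \<noteq> 0"
    \<comment> \<open>Far enough in the direction \<open>- w\<close> the function becomes negative.\<close>
    then have "w \<bullet> (- ((\<bar>b\<bar> + 1) / (w \<bullet> w)) *\<^sub>R w) + b = b - (\<bar>b\<bar> + 1)"
      by simp
    then show False using *[rule_format, of "- ((\<bar>b\<bar> + 1) / (w \<bullet> w)) *\<^sub>R w"] by linarith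
  qed
  with * show "w = 0 \<and> 0 \<le> b" by simp
qed simp

section \<open>The Lyapunov equation\<close>

lemma trajectory_form_deriv:
  assumes x: "is_trajectory M x0 x" and y: "is_trajectory M y0 y" and "t \<ge> 0"
  shows "((\<lambda>t. x t \<bullet> (D *v y t)) has_real_derivative
            (M *v x t) \<bullet> (D *v y t) + x t \<bullet> (D *v (M *v y t))) (at t within {0..})"
proof -
  have "((\<lambda>t. D *v y t) has_vector_derivative D *v (M *v y t)) (at t within {0..})"
    by (rule bounded_linear.has_vector_derivative[OF _ is_trajectory_deriv[OF y \<open>t \<ge> 0\<close>]])
      (simp add: linear_linear[symmetric])
  from bounded_bilinear.has_vector_derivative[OF bounded_bilinear_inner is_trajectory_deriv[OF x \<open>t \<ge> 0\<close>] this]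
  show ?thesis
    by (simp add: has_real_derivative_iff_has_vector_derivative add.commute)
qed

lemma hurwitz_form_tendsto_0:
  assumes "hurwitz M" "is_trajectory M x0 x" "is_trajectory M y0 y"
  shows "((\<lambda>t. x t \<bullet> (D *v y t)) \<longlongrightarrow> 0) at_top"
proof -
  have "((\<lambda>t. D *v y t) \<longlongrightarrow> D *v 0) at_top"
    by (rule bounded_linear.tendsto[OF _ hurwitz_trajectory_tendsto_0[OF assms(1,3)]])
      (simp add: linear_linear[symmetric])
  from tendsto_inner[OF hurwitz_trajectory_tendsto_0[OF assms(1,2)] this] show ?thesis by simp
qed

text \<open>The function \<open>x t \<bullet> P x t\<close> has derivative \<open>- q (x t)\<close> and tends to zero.\<close>
lemma lyapunov_has_integral:
  assumes hur: "hurwitz M" and sym: "transpose P = P" and x: "is_trajectory M x0 x"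
    and lyap: "\<And>x. 2 * ((P *v x) \<bullet> (M *v x)) = - q x"
    and nonneg: "\<And>x. 0 \<le> q x"
  shows "((\<lambda>t. q (x t)) has_integral x0 \<bullet> (P *v x0)) {0..}"
proof -
  define V where "V t = - (x t \<bullet> (P *v x t))" for t
  have V: "(V has_real_derivative q (x t)) (at t within {0..})" if "t \<ge> 0" for t
  proof -
    have "(M *v x t) \<bullet> (P *v x t) + x t \<bullet> (P *v (M *v x t)) = - q (x t)"
      using lyap[of "x t"] symmetric_matrix_inner[OF sym, of "x t" "M *v x t"]
      by (simp add: inner_commute)
    with DERIV_minus[OF trajectory_form_deriv[OF x x that, of P]] show ?thesis
      by (simp add: V_def[abs_def])
  qed
  have int: "((\<lambda>t. q (x t)) has_integral V T - V 0) {0..T}" if "T \<ge> 0" for T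
    by (rule ftc_nonneg_axis[OF V]) (use that in auto)
  show ?thesis
  proof (rule has_integral_to_inf)
    show "(\<lambda>t. q (x t)) integrable_on {0..T}" for T
      by (cases "T \<ge> 0") (use int in auto)
    have "((\<lambda>T. V T - V 0) \<longlongrightarrow> - 0 - V 0) at_top"
      unfolding V_def by (intro tendsto_intros hurwitz_form_tendsto_0[OF hur x x])
    then have "((\<lambda>T. V T - V 0) \<longlongrightarrow> x0 \<bullet> (P *v x0)) at_top"
      by (simp add: V_def is_trajectory_initial[OF x])
    then show "((\<lambda>T. integral {0..T} (\<lambda>t. q (x t))) \<longlongrightarrow> x0 \<bullet> (P *v x0)) at_top"
      by (rule Lim_transform_eventually)
        (auto simp: eventually_at_top_linorder integral_unique[OF int] intro!: exI[of _ 0])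
  qed (use nonneg in auto)
qed

text \<open>The form of \<open>D\<close> decreases along trajectories to its limit 0. All comparisons between cost
  matrices below reduce to this.\<close>
lemma lyapunov_psd:
  assumes hur: "hurwitz M" and sym: "transpose D = D"
    and le: "\<And>x. (D *v x) \<bullet> (M *v x) \<le> 0"
  shows "0 \<le> x \<bullet> (D *v x)"
  by (rule has_integral_nonneg[OF lyapunov_has_integral[OF hur sym trajectory_is_trajectory,
        where q = "\<lambda>x. - (2 * ((D *v x) \<bullet> (M *v x)))"]])
    (use le in auto)

text \<open>The Lyapunov operator is injective: if it kills \<open>P\<close>, then \<open>x t \<bullet> P y t\<close> is constant along any two
  trajectories, and its limit is 0. In finite dimension it is then surjective, and
  injectivity makes the solution symmetric for a symmetric right-hand side. Only the form of \<open>W\<close>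
  matters, so \<open>W\<close> is replaced by its symmetric part.\<close>
lemma lyapunov_solution:
  fixes M W :: "real^'n^'n"
  assumes hur: "hurwitz M"
  obtains P where "transpose P = P" "\<And>x. 2 * ((P *v x) \<bullet> (M *v x)) = - (x \<bullet> (W *v x))"
proof -
  define Op where "Op P = transpose M ** P + P ** M" for P :: "real^'n^'n"
  have form: "x \<bullet> (Op P *v y) = (M *v x) \<bullet> (P *v y) + x \<bullet> (P *v (M *v y))" for P x y
    by (simp add: Op_def matrix_vector_mult_add_rdistrib inner_add_right
        matrix_vector_mul_assoc[symmetric] inner_commute[of x] dot_lmul_matrix)
      (simp add: inner_commute)
  have lin: "linear Op"
    by (rule linearI) (auto intro!: matrix_eqI_bilinear
        simp: form matrix_vector_mult_add_rdistrib inner_add_right scaleR_matrix_vector_assoc[symmetric] algebra_simps)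
  have "P = 0" if "Op P = 0" for P
  proof (rule matrix_eqI_bilinear)
    fix x0 y0
    define x y where "x = trajectory M x0" and "y = trajectory M y0"
    have x: "is_trajectory M x0 x" and y: "is_trajectory M y0 y"
      by (simp_all add: x_def y_def trajectory_is_trajectory)
    define f where "f t = x t \<bullet> (P *v y t)" for t
    have "(f has_real_derivative 0) (at t within {0..})" if "t \<ge> 0" for t
      using trajectory_form_deriv[OF x y that, of P] form[of "x t" P "y t"] \<open>Op P = 0\<close>
      by (simp add: f_def[abs_def])
    then have int: "((\<lambda>_. 0) has_integral f t - f 0) {0..t}" if "t \<ge> 0" for t
      using that by (intro ftc_nonneg_axis) auto
    have const: "f t = f 0" if "t \<ge> 0" for t
      using has_integral_unique[OF int[OF that] has_integral_0] by simp
    have "(f \<longlongrightarrow> f 0) at_top"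
      by (intro tendsto_eventually eventually_mono[OF eventually_ge_at_top[of 0]] const)
    moreover have "(f \<longlongrightarrow> 0) at_top"
      unfolding f_def by (rule hurwitz_form_tendsto_0[OF hur x y])
    ultimately have "f 0 = 0"
      using tendsto_unique trivial_limit_at_top_linorder by blast
    then show "x0 \<bullet> (P *v y0) = x0 \<bullet> (0 *v y0)"
      by (simp add: f_def is_trajectory_initial[OF x] is_trajectory_initial[OF y])
  qed
  then have inj: "inj Op"
    by (simp add: linear_injective_0[OF lin])
  then obtain P where P: "Op P = - ((1/2) *\<^sub>R (W + transpose W))"
    using linear_inj_imp_surj[OF lin] by (metis surjD)
  have "Op (transpose P) = transpose (Op P)"
    by (simp add: Op_def transpose_add matrix_transpose_mul add.commute)
  also have "\<dots> = Op P"
    unfolding P by (simp add: transpose_def vec_eq_iff)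
  finally have sym: "transpose P = P" using inj by (simp add: inj_eq)
  moreover have "2 * ((P *v x) \<bullet> (M *v x)) = - (x \<bullet> (W *v x))" for x
  proof -
    have "2 * ((P *v x) \<bullet> (M *v x)) = x \<bullet> (Op P *v x)"
      using symmetric_matrix_inner[OF sym, of x "M *v x"] by (simp add: form inner_commute)
    also have "\<dots> = - ((1/2) * (x \<bullet> (W *v x) + x \<bullet> (transpose W *v x)))"
      unfolding P by (simp add: scaleR_matrix_vector_assoc[symmetric] matrix_vector_mult_add_rdistrib
          inner_add_right matrix_vector_mult_uminus)
    also have "x \<bullet> (transpose W *v x) = x \<bullet> (W *v x)"
      by (simp add: inner_commute[of x] dot_lmul_matrix)
    finally show ?thesis by simp
  qed
  ultimately show ?thesis using that by blast
qed

text \<open>For an eigenvector \<open>a + i b\<close> with eigenvalue \<open>z\<close>, adding the inequalities at \<open>a\<close> and \<open>b\<close>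
  cancels the contribution of \<open>Im z\<close>.\<close>
lemma hurwitz_of_lyapunov:
  fixes M P :: "real^'n^'n"
  assumes sym: "transpose P = P" and psd: "\<And>x. 0 \<le> x \<bullet> (P *v x)"
    and neg: "\<And>x. x \<noteq> 0 \<Longrightarrow> (P *v x) \<bullet> (M *v x) < 0"
  shows "hurwitz M"
  unfolding hurwitz_def
proof (intro allI impI)
  fix z :: complex and v :: "complex^'n"
  assume "v \<noteq> 0 \<and> map_matrix complex_of_real M *v v = z *s v"
  then have v: "v \<noteq> 0" and eig: "\<And>i. (map_matrix complex_of_real M *v v) $ i = z * v $ i"
    by auto
  define a b where "a = (\<chi> i. Re (v $ i))" and "b = (\<chi> i. Im (v $ i))"
  have Ma: "M *v a = Re z *\<^sub>R a - Im z *\<^sub>R b"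
    unfolding vec_eq_iff
  proof
    fix i
    have "Re ((map_matrix complex_of_real M *v v) $ i) = (M *v a) $ i"
      by (simp add: matrix_vector_mult_def a_def)
    then show "(M *v a) $ i = (Re z *\<^sub>R a - Im z *\<^sub>R b) $ i"
      by (simp add: eig a_def b_def)
  qed
  have Mb: "M *v b = Im z *\<^sub>R a + Re z *\<^sub>R b"
    unfolding vec_eq_iff
  proof
    fix i
    have "Im ((map_matrix complex_of_real M *v v) $ i) = (M *v b) $ i"
      by (simp add: matrix_vector_mult_def b_def)
    then show "(M *v b) $ i = (Im z *\<^sub>R a + Re z *\<^sub>R b) $ i"
      by (simp add: eig a_def b_def)
  qed
  have "a \<noteq> 0 \<or> b \<noteq> 0"
    using v by (auto simp: vec_eq_iff a_def b_def complex_eq_iff)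
  moreover have "(P *v x) \<bullet> (M *v x) \<le> 0" for x
    using neg[of x] by (cases "x = 0") auto
  ultimately have "(P *v a) \<bullet> (M *v a) + (P *v b) \<bullet> (M *v b) < 0"
    using neg[of a] neg[of b] by (metis add_neg_nonpos add_nonpos_neg)
  also have "(P *v a) \<bullet> (M *v a) + (P *v b) \<bullet> (M *v b) = Re z * (a \<bullet> (P *v a) + b \<bullet> (P *v b))"
    using symmetric_matrix_inner[OF sym, of a b]
    by (simp add: Ma Mb inner_diff_right inner_add_right inner_commute algebra_simps)
  finally have "Re z * (a \<bullet> (P *v a) + b \<bullet> (P *v b)) < 0" .
  with psd[of a] psd[of b] show "Re z < 0"
    by (simp add: mult_less_0_iff)
qed

section \<open>The Riccati equation\<close>

lemma continuous_matrix_vector [continuous_intros]: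
  "continuous_on U (\<lambda>P. P *v (x :: real^'n))" for U :: "(real^'n^'n) set"
proof -
  have "linear (\<lambda>P. P *v (x :: real^'n) :: real^'n)"
    by (rule linearI) (simp_all add: matrix_vector_mult_add_rdistrib scaleR_matrix_vector_assoc)
  then show ?thesis by (simp add: linear_continuous_on linear_linear)
qed

text \<open>A linear-quadratic regulator whose running cost has a cross term \<open>S\<close> and is positive away from
  \<open>x = 0\<close> whatever the input is. Feedback is written \<open>v = - F x\<close>.\<close>
locale lq_problem =
  fixes A :: "real^'n^'n" and B :: "real^'k^'n"
    and Q :: "real^'n^'n" and S :: "real^'k^'n" and R :: "real^'k^'k"
  assumes Q_sym: "transpose Q = Q" and R_spd: "sym_pos_def R"
    and cost_pos: "\<And>x v. x \<noteq> 0 \<Longrightarrow> 0 < x \<bullet> (Q *v x) + 2 * (x \<bullet> (S *v v)) + v \<bullet> (R *v v)"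
begin

definition stage_cost :: "real^'n \<Rightarrow> real^'k \<Rightarrow> real" where
  "stage_cost x v = x \<bullet> (Q *v x) + 2 * (x \<bullet> (S *v v)) + v \<bullet> (R *v v)"

text \<open>The input \<open>- (gain P) x\<close> minimises the derivative of \<open>x \<bullet> P x\<close> plus the running cost.\<close>
definition gain :: "real^'n^'n \<Rightarrow> real^'n^'k" where
  "gain P = matrix_inv R ** (transpose B ** P + transpose S)"

definition residual :: "real^'n^'n \<Rightarrow> real^'n^'n" where
  "residual P = transpose A ** P + P ** A
     - (P ** B + S) ** matrix_inv R ** (transpose B ** P + transpose S) + Q"

text \<open>The Lyapunov equation of the closed loop, stated through quadratic forms. If the closed loop is
  Hurwitz, \<open>x0 \<bullet> P x0\<close> is the cost of the feedback \<open>F\<close> from the initial state \<open>x0\<close>.\<close>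
definition value_matrix :: "real^'n^'k \<Rightarrow> real^'n^'n \<Rightarrow> bool" where
  "value_matrix F P \<longleftrightarrow> transpose P = P \<and>
     (\<forall>x. 2 * ((P *v x) \<bullet> ((A - B ** F) *v x)) = - stage_cost x (- (F *v x)))"

text \<open>The sublevel set of the Riccati operator in which a solution is sought.\<close>
definition supersolution :: "real^'n^'n \<Rightarrow> bool" where
  "supersolution P \<longleftrightarrow> transpose P = P \<and> (\<forall>x. 0 \<le> x \<bullet> (P *v x)) \<and> (\<forall>x. x \<bullet> (residual P *v x) \<le> 0)"

lemma R_sym: "transpose R = R" and R_nonneg: "0 \<le> v \<bullet> (R *v v)"
  using R_spd by (cases "v = 0"; auto simp: sym_pos_def_def intro: less_imp_le)+

lemma stage_cost_pos: "x \<noteq> 0 \<Longrightarrow> 0 < stage_cost x v"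
  using cost_pos by (simp add: stage_cost_def)

lemma stage_cost_nonneg: "0 \<le> stage_cost x v"
  using stage_cost_pos[of x v] R_nonneg[of v] by (cases "x = 0") (auto simp: stage_cost_def)

lemma closed_loop_mult: "(A - B ** F) *v x = A *v x + B *v (- (F *v x))"
  by (simp add: matrix_vector_mult_diff_rdistrib matrix_vector_mul_assoc
      matrix_vector_mult_neg)

lemma residual_symmetric:
  assumes "transpose P = P"
  shows "transpose (residual P) = residual P"
  using assms by (simp add: residual_def transpose_add transpose_diff matrix_transpose_mul Q_sym
      sym_pos_def_inverse(3)[OF R_spd] matrix_mul_assoc add.commute)

text \<open>Here \<open>R (gain P x) = (transpose B ** P + transpose S) x\<close>, so the square produces exactly the terms
  linear in \<open>v\<close> and the quadratic term of the Riccati residual.\<close>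
lemma completion_of_squares:
  assumes P: "transpose P = P"
  shows "2 * ((P *v x) \<bullet> (A *v x + B *v v)) + stage_cost x v
    = x \<bullet> (residual P *v x) + (v + gain P *v x) \<bullet> (R *v (v + gain P *v x))"
proof -
  define g where "g = gain P *v x"
  define y where "y = (transpose B ** P + transpose S) *v x"
  have Rg: "R *v g = y"
    unfolding g_def y_def gain_def
    by (simp add: matrix_vector_mul_assoc matrix_mul_assoc sym_pos_def_inverse(1)[OF R_spd])
  have y_inner: "y \<bullet> w = (P *v x) \<bullet> (B *v w) + x \<bullet> (S *v w)" for w
    by (simp add: y_def matrix_vector_mult_add_rdistrib inner_add_left
        matrix_vector_mul_assoc[symmetric] dot_lmul_matrix)
  have "x \<bullet> ((transpose A ** P + P ** A) *v x) = 2 * ((P *v x) \<bullet> (A *v x))"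
    using symmetric_matrix_inner[OF P, of x "A *v x"]
    by (simp add: matrix_vector_mult_add_rdistrib inner_add_right
        matrix_vector_mul_assoc[symmetric] dot_lmul_matrix inner_commute[of x])
  moreover have "x \<bullet> (((P ** B + S) ** matrix_inv R ** (transpose B ** P + transpose S)) *v x) = y \<bullet> g"
  proof -
    have "((P ** B + S) ** matrix_inv R ** (transpose B ** P + transpose S)) *v x = (P ** B + S) *v g"
      by (simp add: g_def gain_def matrix_vector_mul_assoc matrix_mul_assoc)
    then show ?thesis
      using symmetric_matrix_inner[OF P, of x "B *v g"]
      by (simp add: y_inner matrix_vector_mult_add_rdistrib inner_add_right matrix_vector_mul_assoc[symmetric])
  qed
  ultimately have res: "x \<bullet> (residual P *v x) = 2 * ((P *v x) \<bullet> (A *v x)) - y \<bullet> g + x \<bullet> (Q *v x)"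
    by (simp add: residual_def matrix_vector_mult_add_rdistrib matrix_vector_mult_diff_rdistrib
        inner_add_right inner_diff_right)
  have "(v + g) \<bullet> (R *v (v + g)) = v \<bullet> (R *v v) + 2 * (y \<bullet> v) + y \<bullet> g"
    using symmetric_matrix_inner[OF R_sym, of g v] Rg
    by (simp add: matrix_vector_right_distrib inner_add_left inner_add_right inner_commute)
  then show ?thesis
    by (simp add: res stage_cost_def y_inner g_def[symmetric] inner_add_right)
qed

lemma closed_loop_form:
  assumes "transpose P = P"
  shows "2 * ((P *v x) \<bullet> ((A - B ** F) *v x)) = x \<bullet> (residual P *v x) - stage_cost x (- (F *v x))
    + ((gain P - F) *v x) \<bullet> (R *v ((gain P - F) *v x))"
  using completion_of_squares[OF assms, of x "- (F *v x)"]
  unfolding closed_loop_mult by (simp add: matrix_vector_mult_diff_rdistrib)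

lemma closed_loop_form_gain:
  assumes "transpose P = P"
  shows "2 * ((P *v x) \<bullet> ((A - B ** gain P) *v x))
    = x \<bullet> (residual P *v x) - stage_cost x (- (gain P *v x))"
  using closed_loop_form[OF assms, of x "gain P"] by simp

lemma value_matrix_exists:
  assumes "hurwitz (A - B ** F)"
  obtains P where "value_matrix F P"
proof -
  define W where "W = Q - 2 *\<^sub>R (S ** F) + transpose F ** R ** F"
  have "x \<bullet> (W *v x) = stage_cost x (- (F *v x))" for x
    by (simp add: W_def stage_cost_def matrix_vector_mult_add_rdistrib matrix_vector_mult_diff_rdistrib
        inner_add_right inner_diff_right scaleR_matrix_vector_assoc[symmetric]
        matrix_vector_mul_assoc[symmetric] inner_commute[of x "_ v* F"] dot_lmul_matrix
        matrix_vector_mult_neg)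
      (simp add: inner_commute)
  then show ?thesis
    using lyapunov_solution[OF assms, of W] that unfolding value_matrix_def by metis
qed

lemma value_matrix_has_integral:
  assumes hur: "hurwitz (A - B ** F)" and val: "value_matrix F P"
    and x: "is_trajectory (A - B ** F) x0 x"
  shows "((\<lambda>t. stage_cost (x t) (- (F *v x t))) has_integral x0 \<bullet> (P *v x0)) {0..}"
  using val by (intro lyapunov_has_integral[OF hur _ x, where q = "\<lambda>x. stage_cost x (- (F *v x))"])
    (auto simp: value_matrix_def stage_cost_nonneg)

text \<open>Positivity is the Lyapunov comparison; the residual is minus the square in
  \<open>closed_loop_form\<close>.\<close>
lemma value_matrix_supersolution:
  assumes hur: "hurwitz (A - B ** F)" and val: "value_matrix F P"
  shows "supersolution P"
proof -
  have sym: "transpose P = P"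
    and lyap: "2 * ((P *v x) \<bullet> ((A - B ** F) *v x)) = - stage_cost x (- (F *v x))" for x
    using val by (auto simp: value_matrix_def)
  have "0 \<le> x \<bullet> (P *v x)" for x
    by (rule lyapunov_psd[OF hur sym])
      (use lyap stage_cost_nonneg in \<open>smt (verit)\<close>)
  moreover have "x \<bullet> (residual P *v x) \<le> 0" for x
    using closed_loop_form[OF sym, of x F] lyap[of x] R_nonneg[of "(gain P - F) *v x"] by simp
  ultimately show ?thesis by (simp add: supersolution_def sym)
qed

text \<open>The form of \<open>P\<close> decreases strictly in the closed loop with \<open>gain P\<close>, by at least the running cost.
  If \<open>P\<close> were degenerate it would annihilate some \<open>x \<noteq> 0\<close>, and the derivative at \<open>x\<close> would be 0.\<close>
lemma supersolution_stabilizing: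
  assumes P: "supersolution P"
  shows "sym_pos_def P" "hurwitz (A - B ** gain P)"
proof -
  have sym: "transpose P = P" and psd: "\<And>x. 0 \<le> x \<bullet> (P *v x)"
    and res: "\<And>x. x \<bullet> (residual P *v x) \<le> 0"
    using P by (auto simp: supersolution_def)
  have neg: "(P *v x) \<bullet> ((A - B ** gain P) *v x) < 0" if "x \<noteq> 0" for x
    using closed_loop_form_gain[OF sym, of x] res[of x] stage_cost_pos[OF that, of "- (gain P *v x)"]
    by simp
  then show "hurwitz (A - B ** gain P)"
    by (rule hurwitz_of_lyapunov[OF sym psd])
  have "x \<bullet> (P *v x) \<noteq> 0" if "x \<noteq> 0" for x
    using psd_isotropic_in_kernel[OF sym psd, of x] neg[OF that] by auto
  then show "sym_pos_def P"
    using sym psd by (auto simp: sym_pos_def_def less_le)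
qed

lemma solution_supersolution:
  assumes "sym_pos_def P" "residual P = 0"
  shows "supersolution P"
  using assms unfolding sym_pos_def_def supersolution_def
  by (metis inner_zero_left inner_zero_right less_imp_le matrix_vector_mult_0 order_refl)

lemma solution_value_matrix:
  assumes "sym_pos_def P" "residual P = 0"
  shows "value_matrix (gain P) P"
  using closed_loop_form_gain[of P] assms by (simp add: value_matrix_def sym_pos_def_def)

text \<open>In the closed loop with \<open>F\<close> both forms lose the running cost, but that of \<open>P\<close> gains the square
  of \<open>(gain P - F) x\<close>; so \<open>D - P\<close> decreases.\<close>
lemma solution_le_value_matrix:
  assumes P: "sym_pos_def P" "residual P = 0"
    and hur: "hurwitz (A - B ** F)" and val: "value_matrix F D"
  shows "x \<bullet> (P *v x) \<le> x \<bullet> (D *v x)"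
proof -
  have sym: "transpose P = P" "transpose D = D"
    using P val by (auto simp: sym_pos_def_def value_matrix_def)
  have "0 \<le> x \<bullet> ((D - P) *v x)"
  proof (rule lyapunov_psd[OF hur])
    show "transpose (D - P) = D - P" by (simp add: transpose_diff sym)
    fix x
    have "2 * ((D *v x) \<bullet> ((A - B ** F) *v x)) = - stage_cost x (- (F *v x))"
      using val by (simp add: value_matrix_def)
    then show "((D - P) *v x) \<bullet> ((A - B ** F) *v x) \<le> 0"
      using closed_loop_form[OF sym(1), of x F] P(2) R_nonneg[of "(gain P - F) *v x"]
      by (simp add: matrix_vector_mult_diff_rdistrib[of D] inner_diff_left)
  qed
  then show ?thesis by (simp add: matrix_vector_mult_diff_rdistrib inner_diff_right)
qed

text \<open>Each solution is the value matrix of its own stabilizing gain, hence lies above the other one.\<close>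
lemma solution_unique:
  assumes P: "sym_pos_def P" "residual P = 0" and D: "sym_pos_def D" "residual D = 0"
  shows "P = D"
proof (rule symmetric_matrix_eqI_quadratic)
  have le: "x \<bullet> (X *v x) \<le> x \<bullet> (Y *v x)"
    if "sym_pos_def X" "residual X = 0" and Y: "sym_pos_def Y" "residual Y = 0" for X Y x
    by (rule solution_le_value_matrix[OF that(1,2) _ solution_value_matrix[OF Y]])
      (rule supersolution_stabilizing[OF solution_supersolution[OF Y]])
  show "x \<bullet> (P *v x) = x \<bullet> (D *v x)" for x
    using le[OF P D, of x] le[OF D P, of x] by simp
qed (use P D in \<open>simp_all add: sym_pos_def_def\<close>)

text \<open>\<open>P'\<close> is the value matrix of \<open>gain P\<close>. In that closed loop the form of \<open>P - P'\<close> has derivative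
  \<open>x \<bullet> residual P x\<close>, which is nonpositive, and which vanishes if \<open>P' = P\<close>.\<close>
lemma policy_improvement:
  assumes P: "supersolution P"
  obtains P' where "supersolution P'" "\<And>x. 0 \<le> x \<bullet> ((P - P') *v x)"
    "P' = P \<Longrightarrow> residual P = 0"
proof -
  have sym: "transpose P = P" and res: "\<And>x. x \<bullet> (residual P *v x) \<le> 0"
    using P by (auto simp: supersolution_def)
  have hur: "hurwitz (A - B ** gain P)" by (rule supersolution_stabilizing[OF P])
  then obtain P' where val: "value_matrix (gain P) P'" by (rule value_matrix_exists)
  then have sym': "transpose P' = P'"
    and lyap': "\<And>x. 2 * ((P' *v x) \<bullet> ((A - B ** gain P) *v x)) = - stage_cost x (- (gain P *v x))"
    by (auto simp: value_matrix_def)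
  show ?thesis
  proof
    show "supersolution P'" by (rule value_matrix_supersolution[OF hur val])
    show "0 \<le> x \<bullet> ((P - P') *v x)" for x
    proof (rule lyapunov_psd[OF hur])
      show "transpose (P - P') = P - P'" by (simp add: transpose_diff sym sym')
      show "((P - P') *v x) \<bullet> ((A - B ** gain P) *v x) \<le> 0" for x
        using closed_loop_form_gain[OF sym, of x] res[of x] lyap'[of x]
        by (simp add: matrix_vector_mult_diff_rdistrib[of P] inner_diff_left)
    qed
    show "residual P = 0" if "P' = P"
    proof (rule symmetric_matrix_eqI_quadratic[OF residual_symmetric[OF sym]])
      show "transpose (0 :: real^'n^'n) = 0" by (simp add: transpose_def vec_eq_iff)
      show "x \<bullet> (residual P *v x) = x \<bullet> (0 *v x)" for x
        using closed_loop_form_gain[OF sym, of x] lyap'[of x] that by simp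
    qed
  qed
qed

text \<open>Completing the square at \<open>v = 0\<close> expresses the residual through \<open>P x\<close> alone, which
  depends continuously on \<open>P\<close>.\<close>
lemma closed_supersolutions: "closed {P. supersolution P \<and> trace P \<le> c}"
proof -
  have "supersolution P \<longleftrightarrow> transpose P = P \<and> (\<forall>x. 0 \<le> x \<bullet> (P *v x)) \<and>
      (\<forall>x. 2 * ((P *v x) \<bullet> (A *v x)) + x \<bullet> (Q *v x)
        \<le> (matrix_inv R *v (transpose B *v (P *v x) + transpose S *v x)) \<bullet>
           (transpose B *v (P *v x) + transpose S *v x))" for P
  proof -
    have "gain P *v x = matrix_inv R *v (transpose B *v (P *v x) + transpose S *v x)" for x
      by (simp add: gain_def matrix_vector_mul_assoc[symmetric] matrix_vector_mult_add_rdistrib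
          del: transpose_matrix_vector)
    moreover have "R *v (gain P *v x) = transpose B *v (P *v x) + transpose S *v x" for x
      unfolding calculation matrix_vector_mul_assoc sym_pos_def_inverse(1)[OF R_spd] by simp
    ultimately show ?thesis
      unfolding supersolution_def
      using completion_of_squares[of P _ 0]
      by (auto simp: stage_cost_def simp del: transpose_matrix_vector)
  qed
  then have "{P. supersolution P \<and> trace P \<le> c} = {P. transpose P = P} \<inter> {P. \<forall>x. 0 \<le> x \<bullet> (P *v x)} \<inter>
      {P. \<forall>x. 2 * ((P *v x) \<bullet> (A *v x)) + x \<bullet> (Q *v x)
        \<le> (matrix_inv R *v (transpose B *v (P *v x) + transpose S *v x)) \<bullet>
           (transpose B *v (P *v x) + transpose S *v x)} \<inter> {P. trace P \<le> c}"
    by blast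
  moreover have "closed {P :: real^'n^'n. transpose P = P}"
  proof (intro closed_Collect_eq continuous_on_id)
    have "linear (transpose :: real^'n^'n \<Rightarrow> real^'n^'n)"
      by (rule linearI) (simp_all add: transpose_add transpose_scalar)
    then show "continuous_on UNIV (transpose :: real^'n^'n \<Rightarrow> real^'n^'n)"
      by (simp add: linear_continuous_on linear_linear)
  qed
  moreover have "closed {P :: real^'n^'n. trace P \<le> c}"
    unfolding trace_def by (intro closed_Collect_le continuous_intros)
  ultimately show ?thesis
    by (auto intro!: closed_Int closed_Collect_all closed_Collect_le continuous_intros
        bounded_linear.continuous_on[of "\<lambda>v. matrix_inv R *v v"]
        bounded_linear.continuous_on[of "\<lambda>v. transpose B *v v"]
        simp: linear_linear[symmetric] simp del: transpose_matrix_vector)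
qed

text \<open>Among the supersolutions pick one of minimal trace. Its improvement is smaller and cannot have
  smaller trace, so the positive semidefinite difference has trace zero and vanishes.\<close>
theorem riccati_solution_exists:
  assumes stab: "stabilizable A B"
  obtains P where "sym_pos_def P" "residual P = 0"
proof -
  obtain F P0 where F: "hurwitz (A - B ** F)" "value_matrix F P0"
    using stab value_matrix_exists unfolding stabilizable_def by metis
  have P0: "supersolution P0" by (rule value_matrix_supersolution[OF F])
  define X where "X = {P. supersolution P \<and> trace P \<le> trace P0}"
  have "norm P \<le> real (CARD('n)\<^sup>2) * trace P0" if "P \<in> X" for P
  proof -
    have "norm P \<le> real (CARD('n)\<^sup>2) * trace P"
      using that by (intro psd_norm_le_trace) (auto simp: X_def supersolution_def)
    also have "\<dots> \<le> real (CARD('n)\<^sup>2) * trace P0"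
      using that by (intro mult_left_mono) (auto simp: X_def)
    finally show ?thesis .
  qed
  then have "bounded X" unfolding bounded_iff by blast
  then have "compact X"
    unfolding compact_eq_bounded_closed X_def using closed_supersolutions by blast
  moreover have "X \<noteq> {}" using P0 by (auto simp: X_def)
  moreover have "continuous_on X trace"
    unfolding trace_def by (intro continuous_intros)
  ultimately obtain P where P: "P \<in> X" and min: "\<And>P'. P' \<in> X \<Longrightarrow> trace P \<le> trace P'"
    using continuous_attains_inf by metis
  have sup: "supersolution P" using P by (simp add: X_def)
  obtain P' where P': "supersolution P'" "\<And>x. 0 \<le> x \<bullet> ((P - P') *v x)" "P' = P \<Longrightarrow> residual P = 0"
    using policy_improvement[OF sup] by blast
  have sym: "transpose (P - P') = P - P'"
    using sup P'(1) by (simp add: supersolution_def transpose_diff)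
  have "trace (P - P') \<le> 0"
  proof (cases "P' \<in> X")
    case True
    then show ?thesis using min by (simp add: trace_sub)
  next
    case False
    \<comment> \<open>Outside \<open>X\<close> the trace exceeds that of \<open>P0\<close>, hence that of \<open>P\<close>.\<close>
    then have "trace P \<le> trace P'" using P P'(1) by (simp add: X_def)
    then show ?thesis by (simp add: trace_sub)
  qed
  then have "real (CARD('n)\<^sup>2) * trace (P - P') \<le> 0"
    by (intro mult_nonneg_nonpos) auto
  then have "norm (P - P') \<le> 0"
    using psd_norm_le_trace[OF sym P'(2)] by linarith
  then have "residual P = 0" using P'(3) by simp
  then show ?thesis using that supersolution_stabilizing(1)[OF sup] by blast
qed

end

section \<open>The optimal feasible gain\<close>

theorem theorem6:
  fixes A :: "real^'n^'n" and B :: "real^'m^'n"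
    and p pbar :: nat
    and c :: "nat \<Rightarrow> real^'n" and d :: "nat \<Rightarrow> real"
    and r :: "nat \<Rightarrow> nat" and \<alpha> :: "nat \<Rightarrow> nat \<Rightarrow> real"
    and ell :: "nat \<Rightarrow> real^'m"
    and idx :: "'p::finite \<Rightarrow> nat"
    and L :: "real^'p^'m" and Lperp :: "real^'q^'m"
    and Ctilde :: "real^'n^'p" and K0 :: "real^'n^'m"
    and Q :: "real^'n^'n" and R :: "real^'m^'m"
    and As :: "real^'n^'n" and Bs :: "real^'q^'n" and Qs :: "real^'n^'n"
    and Ss :: "real^'q^'n" and Rs :: "real^'q^'q"
    and Kstar :: "real^'n^'n \<Rightarrow> real^'n^'m"
  assumes reldeg: "\<And>i. i \<in> {1..pbar} \<Longrightarrow> has_relative_degree A B (c i) (r i)"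
    and alpha_pos: "\<And>i j. i \<in> {1..pbar} \<Longrightarrow> j \<in> {1..r i} \<Longrightarrow> \<alpha> i j > 0"
    and ell_eq: "\<And>i. ell i = transpose B *v (transpose (mat_pow A (r i - 1)) *v c i)"
    and p_le: "p \<le> pbar"
    and ell_indep: "inj_on ell {1..p}" "independent (ell ` {1..p})"
    and ell_dep: "\<And>i. i \<in> {p+1..pbar} \<Longrightarrow> ell i \<in> span (ell ` {1..p})"
    and p_less: "p < CARD('m)"
    (* the type p of column indices of L is enumerated by idx *)
    and idx: "bij_betw idx (UNIV :: 'p set) {1..p}"
    and q_card: "CARD('q) = CARD('m) - p"
    and L: "L = (\<chi> a j. ell (idx j) $ a)"
    and Lperp: "inj (\<lambda>j. column j Lperp)" "independent (columns Lperp)"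
      "span (columns Lperp) = {v. transpose L *v v = 0}"
    and Ctilde: "Ctilde = (\<chi> j. c (idx j) v* hocbf_poly A (\<alpha> (idx j)) (r (idx j)))"
    and K0: "K0 = L ** matrix_inv (transpose L ** L) ** Ctilde"
    and d_nonneg: "\<And>i. i \<in> {1..pbar} \<Longrightarrow> d i \<ge> 0"
    and compat: "\<And>i. i \<in> {1..pbar} - {1..p} \<Longrightarrow>
      c i v* hocbf_poly A (\<alpha> i) (r i) - ell i v* K0 = 0"
    and stab: "stabilizable (A - B ** K0) (B ** Lperp)"
    and Q: "sym_pos_def Q" and R: "sym_pos_def R"
    and As: "As = A - B ** K0"
    and Bs: "Bs = B ** Lperp"
    and Qs: "Qs = Q + transpose K0 ** R ** K0"
    and Ss: "Ss = - (transpose K0 ** R ** Lperp)"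
    and Rs: "Rs = transpose Lperp ** R ** Lperp"
    and Kstar: "\<And>P. Kstar P = K0 + Lperp ** matrix_inv Rs ** (transpose Bs ** P + transpose Ss)"
  shows "(\<exists>!P. sym_pos_def P \<and> gen_riccati As Bs Qs Ss Rs P) \<and>
    (\<forall>P. sym_pos_def P \<and> gen_riccati As Bs Qs Ss Rs P \<longrightarrow>
      Kstar P \<in> feasible_gains A B pbar c d r \<alpha> \<and>
      (\<forall>x0. \<forall>K \<in> feasible_gains A B pbar c d r \<alpha>.
         lq_cost A B Q R x0 (Kstar P) \<le> lq_cost A B Q R x0 K))"
proof -
  have Rsym: "transpose R = R" and Rpos: "\<And>u. 0 \<le> u \<bullet> (R *v u)"
    using R by (auto simp: sym_pos_def_def) (metis inner_zero_left less_imp_le order_refl)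
  have Lperp_ker: "y = 0" if "Lperp *v y = 0" for y
    by (rule independent_columns_kernel[OF Lperp(1,2) that])
  have Rs_spd: "sym_pos_def Rs"
    unfolding Rs by (rule sym_pos_def_congruence[OF R Lperp_ker])

  have idx_range: "range idx = {1..p}" using idx by (simp add: bij_betw_def)
  then have idx_in: "idx j \<in> {1..p}" for j by blast
  have column_L: "column j L = ell (idx j)" for j by (simp add: L column_def vec_eq_iff)
  have L_ker: "y = 0" if "L *v y = 0" for y
  proof (rule independent_columns_kernel[OF _ _ that])
    show "inj (\<lambda>j. column j L)"
      using ell_indep(1) idx idx_in unfolding column_L
      by (auto simp: inj_def bij_betw_def inj_on_def)
    have "columns L = ell ` idx ` UNIV"
      by (auto simp: columns_def column_L)
    then show "independent (columns L)"
      using ell_indep(2) idx by (simp add: bij_betw_def)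
  qed
  have "sym_pos_def (transpose L ** mat 1 ** L)"
    by (rule sym_pos_def_congruence[OF _ L_ker]) (simp add: sym_pos_def_def)
  then have gram: "sym_pos_def (transpose L ** L)" by simp
  have LT_K0: "transpose L ** K0 = Ctilde"
    by (simp add: K0 matrix_mul_assoc sym_pos_def_inverse(1)[OF gram])
  have LT_row: "(transpose L ** K) $ j = ell (idx j) v* K" for K :: "real^'n^'m" and j
    by (simp add: vec_eq_iff matrix_matrix_mult_def vector_matrix_mult_def transpose_def L mult.commute)

  have range_Lperp: "\<exists>y. v = Lperp *v y" if "transpose L *v v = 0" for v
  proof -
    have "v \<in> span (columns Lperp)" using that Lperp(3) by simp
    moreover have "span (columns Lperp) \<subseteq> range (\<lambda>y. Lperp *v y)"
    proof (rule span_minimal)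
      show "columns Lperp \<subseteq> range (\<lambda>y. Lperp *v y)"
        by (auto simp: columns_def simp flip: matrix_vector_mult_basis)
      show "subspace (range (\<lambda>y. Lperp *v y))"
        by (rule linear_subspace_image) auto
    qed
    ultimately show ?thesis by auto
  qed
  have L_Lperp: "transpose L ** Lperp = 0"
  proof -
    have "transpose L *v (Lperp *v axis k 1) = 0" for k
      using Lperp(3) span_base[of "column k Lperp" "columns Lperp"]
      by (auto simp: columns_def matrix_vector_mult_basis)
    then have "column k (transpose L ** Lperp) = 0" for k
      by (simp only: matrix_vector_mult_basis[symmetric] matrix_vector_mul_assoc)
    then show ?thesis by (simp add: column_def vec_eq_iff)
  qed
  have ell_Lperp: "ell i v* Lperp = 0" if "i \<in> {1..pbar}" for i
  proof -
    have "ell i \<in> span (ell ` {1..p})"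
      using that ell_dep[of i] by (cases "i \<le> p") (auto intro: span_base)
    moreover have "span (ell ` {1..p}) \<subseteq> {w. w v* Lperp = 0}"
    proof (rule span_minimal)
      have "ell j v* Lperp = 0" if j: "j \<in> {1..p}" for j
      proof -
        obtain k where "j = idx k" using j unfolding idx_range[symmetric] by blast
        moreover have "(transpose L ** Lperp) $ k = ell (idx k) v* Lperp"
          by (simp add: vec_eq_iff matrix_matrix_mult_def vector_matrix_mult_def transpose_def L mult.commute)
        ultimately show ?thesis by (simp add: L_Lperp)
      qed
      then show "ell ` {1..p} \<subseteq> {w. w v* Lperp = 0}" by blast
      show "subspace {w. w v* Lperp = 0}"
        by (auto simp: subspace_def vector_matrix_left_distrib scaleR_vector_matrix_assoc)
    qed
    ultimately show ?thesis by blast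
  qed

  have constraint: "(\<forall>x. hocbf_constraint A B (c i) (d i) (r i) (\<alpha> i) x (- (K *v x)))
      \<longleftrightarrow> ell i v* K = c i v* hocbf_poly A (\<alpha> i) (r i)" if i: "i \<in> {1..pbar}" for i K
  proof -
    have ell: "c i v* (mat_pow A (r i - 1) ** B) = ell i"
      by (simp add: ell_eq vector_matrix_mul_assoc)
    have nonneg: "0 \<le> (\<Prod>j=1..r i. \<alpha> i j) * d i"
      using alpha_pos[OF i] d_nonneg[OF i] by (intro mult_nonneg_nonneg prod_nonneg) (auto intro: less_imp_le)
    have constraint_iff: "hocbf_constraint A B (c i) (d i) (r i) (\<alpha> i) x (- (K *v x)) \<longleftrightarrow>
        0 \<le> (c i v* hocbf_poly A (\<alpha> i) (r i) - ell i v* K) \<bullet> x + (\<Prod>j=1..r i. \<alpha> i j) * d i" for x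
      unfolding hocbf_constraint_def ell by (simp add: inner_diff_left dot_lmul_matrix)
    show ?thesis
      unfolding constraint_iff affine_nonneg_everywhere_iff using nonneg by auto
  qed
  have feasible_equations: "K \<in> feasible_gains A B pbar c d r \<alpha> \<longleftrightarrow> hurwitz (A - B ** K) \<and>
      (\<forall>i\<in>{1..pbar}. ell i v* K = c i v* hocbf_poly A (\<alpha> i) (r i))" for K
    unfolding feasible_gains_def by (simp only: mem_Collect_eq constraint cong: ball_cong)
  have closed_loop: "A - B ** (K0 + Lperp ** F) = As - Bs ** F" for F
    by (simp add: As Bs matrix_add_ldistrib matrix_mul_assoc)
  have feasible_iff: "K \<in> feasible_gains A B pbar c d r \<alpha> \<longleftrightarrow>
      (\<exists>F. K = K0 + Lperp ** F \<and> hurwitz (As - Bs ** F))" for K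
  proof
    assume K: "K \<in> feasible_gains A B pbar c d r \<alpha>"
    have "transpose L ** K = Ctilde"
    proof -
      have "(transpose L ** K) $ j = Ctilde $ j" for j
        using K idx_in[of j] p_le by (simp add: feasible_equations LT_row Ctilde)
      then show ?thesis by (simp add: vec_eq_iff)
    qed
    \<comment> \<open>\<open>Rs\<^sup>-\<^sup>1 Lperp\<^sup>T R\<close> is a left inverse of \<open>Lperp\<close>, and \<open>K - K0\<close> maps into the range of \<open>Lperp\<close>.\<close>
    define F where "F = matrix_inv Rs ** transpose Lperp ** R ** (K - K0)"
    have "(K - K0) *v x = (Lperp ** F) *v x" for x
    proof -
      have "transpose L *v ((K - K0) *v x) = 0"
        using \<open>transpose L ** K = Ctilde\<close> LT_K0
        by (simp add: matrix_vector_mul_assoc matrix_vector_mult_diff_distrib matrix_vector_mult_diff_rdistrib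
            del: transpose_matrix_vector)
      then obtain y where y: "(K - K0) *v x = Lperp *v y" using range_Lperp by blast
      have "(Lperp ** F) *v x = Lperp *v ((matrix_inv Rs ** transpose Lperp ** R) *v ((K - K0) *v x))"
        by (simp only: F_def matrix_vector_mul_assoc matrix_mul_assoc)
      also have "\<dots> = Lperp *v ((matrix_inv Rs ** Rs) *v y)"
        unfolding y by (simp only: Rs matrix_vector_mul_assoc matrix_mul_assoc)
      finally show ?thesis by (simp add: y sym_pos_def_inverse(2)[OF Rs_spd])
    qed
    then have "K - K0 = Lperp ** F" by (simp add: matrix_eq)
    then have "K = K0 + Lperp ** F" by (simp add: algebra_simps)
    with K show "\<exists>F. K = K0 + Lperp ** F \<and> hurwitz (As - Bs ** F)"
      using closed_loop by (auto simp: feasible_equations)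
  next
    assume "\<exists>F. K = K0 + Lperp ** F \<and> hurwitz (As - Bs ** F)"
    then obtain F where K: "K = K0 + Lperp ** F" and hur: "hurwitz (As - Bs ** F)" by blast
    have "ell i v* K = c i v* hocbf_poly A (\<alpha> i) (r i)" if i: "i \<in> {1..pbar}" for i
    proof -
      have "ell i v* K = ell i v* K0"
        by (simp add: K vector_matrix_mult_add_rdistrib vector_matrix_mul_assoc[symmetric] ell_Lperp[OF i])
      also have "\<dots> = c i v* hocbf_poly A (\<alpha> i) (r i)"
      proof (cases "i \<in> {1..p}")
        case True
        then obtain j where "i = idx j" unfolding idx_range[symmetric] by blast
        then show ?thesis using LT_row[of K0 j] by (simp add: LT_K0 Ctilde)
      qed (use compat i in auto)
      finally show ?thesis .
    qed
    then show "K \<in> feasible_gains A B pbar c d r \<alpha>"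
      using hur closed_loop by (simp add: feasible_equations K)
  qed

  \<comment> \<open>The second term is the control cost of the input \<open>u = - K0 x + Lperp v\<close>.\<close>
  have reduced_cost: "x \<bullet> (Qs *v x) + 2 * (x \<bullet> (Ss *v v)) + v \<bullet> (Rs *v v)
      = x \<bullet> (Q *v x) + (K0 *v x - Lperp *v v) \<bullet> (R *v (K0 *v x - Lperp *v v))" for x v
  proof -
    show ?thesis
      using symmetric_matrix_inner[OF Rsym, of "K0 *v x" "Lperp *v v"]
      by (simp add: Qs Ss Rs inner_congruence matrix_vector_mult_add_rdistrib matrix_vector_mult_uminus inner_add_right
          matrix_vector_mult_diff_distrib inner_diff_left inner_diff_right inner_commute)
  qed
  interpret lq_problem As Bs Qs Ss Rs
  proof
    show "transpose Qs = Qs"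
      using Q by (simp add: Qs transpose_add matrix_transpose_mul matrix_mul_assoc Rsym sym_pos_def_def)
    show "0 < x \<bullet> (Qs *v x) + 2 * (x \<bullet> (Ss *v v)) + v \<bullet> (Rs *v v)" if "x \<noteq> 0" for x v
      using Q that Rpos by (simp add: reduced_cost sym_pos_def_def add_pos_nonneg)
  qed (rule Rs_spd)
  have riccati_iff: "gen_riccati As Bs Qs Ss Rs P \<longleftrightarrow> residual P = 0" for P
    by (simp add: gen_riccati_def residual_def)
  have Kstar_gain: "Kstar P = K0 + Lperp ** gain P" for P
    by (simp add: Kstar gain_def matrix_mul_assoc)
  have cost: "lq_cost A B Q R x0 (K0 + Lperp ** F) = x0 \<bullet> (P *v x0)"
    if "hurwitz (As - Bs ** F)" "value_matrix F P" for F P x0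
  proof -
    have "x \<bullet> (Q *v x) + ((K0 + Lperp ** F) *v x) \<bullet> (R *v ((K0 + Lperp ** F) *v x))
        = stage_cost x (- (F *v x))" for x
      unfolding stage_cost_def reduced_cost
      by (simp add: matrix_vector_mult_add_rdistrib matrix_vector_mul_assoc
          matrix_vector_mult_neg)
    then show ?thesis
      using value_matrix_has_integral[OF that trajectory_is_trajectory]
      by (simp add: lq_cost_def Let_def closed_loop integral_unique)
  qed

  obtain P where "sym_pos_def P" "residual P = 0"
    using riccati_solution_exists stab by (auto simp: As Bs)
  moreover have "Kstar P \<in> feasible_gains A B pbar c d r \<alpha> \<and>
      (\<forall>x0. \<forall>K \<in> feasible_gains A B pbar c d r \<alpha>. lq_cost A B Q R x0 (Kstar P) \<le> lq_cost A B Q R x0 K)"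
    if P: "sym_pos_def P" "residual P = 0" for P
  proof (intro conjI allI ballI)
    have hur: "hurwitz (As - Bs ** gain P)"
      by (rule supersolution_stabilizing[OF solution_supersolution[OF P]])
    then show "Kstar P \<in> feasible_gains A B pbar c d r \<alpha>"
      unfolding feasible_iff Kstar_gain by blast
    fix x0 K assume "K \<in> feasible_gains A B pbar c d r \<alpha>"
    then obtain F where K: "K = K0 + Lperp ** F" and F: "hurwitz (As - Bs ** F)"
      unfolding feasible_iff by blast
    obtain D where D: "value_matrix F D" by (rule value_matrix_exists[OF F])
    show "lq_cost A B Q R x0 (Kstar P) \<le> lq_cost A B Q R x0 K"
      unfolding Kstar_gain K cost[OF hur solution_value_matrix[OF P]] cost[OF F D]
      by (rule solution_le_value_matrix[OF P F D])
  qed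
  ultimately show ?thesis
    unfolding riccati_iff using solution_unique by blast
qed

end
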